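(* Let $\mathbb{X}$ be a finite dimensional real inner product space, $f:\mathbb{X}\to\mathbb{R}$ be $L_f$-smooth, $g:\mathbb{X}\to(-\infty,\infty]$ be proper, lower semicontinuous and bounded below, and let $F:=f+g$ be coercive and bounded below. Suppose that $F$ is a KL function. Let $\{x^k\}_{k\in\mathbb{N}}$ be the sequence generated by the PGenls algorithm (described in the context) with $\delta\in(0,1/2)$, and let $z^k:=(x^k,x^{k-1})$. Then the following statements hold. (i) Let $K_1:=\big\{k\in\mathbb{N}\,|\,H_\delta(z^{\ell(k+1)})-H_\delta(z^{k+1})\ge\frac{\alpha}{4}\|z^{k+1}-z^k\|^2\big\}$. If $$\sum_{k\in K_1}\sqrt{H_\delta(z^{\ell(k+1)})-H_\delta(z^{k+1})}<\infty\quad\text{whenever}\quad\liminf_{K_1\ni k\to\infty}\frac{H_\delta(z^{\ell(k)})-H_\delta(z^{\ell(k+1)})}{\|z^{k+1}-z^k\|^2}=0,$$ then $\sum_{k=1}^\infty\|z^k-z^{k-1}\|<\infty$. (ii) Suppose that $F$ is a KL function of exponent $\theta\in[1/2,1)$. Let $\omega^*:=\lim_{k\to\infty}H_\delta(z^k)$ (this limit exists), $$K_2:=\big\{k\in\mathbb{N}\,|\,\tfrac{\alpha}{4}\|z^{k+1}-z^k\|^2\le H_\delta(z^{\ell(k+1)})-H_\delta(z^{k+1})<\tfrac{\alpha}{4}\|z^{k+1}-z^k\|^{\frac1\theta}\big\},$$ $$K_{31}:=\big\{k\in K_1\setminus K_2\,|\,\omega^*-H_\delta(z^{k+1})>\tfrac{\alpha}{8}\|z^{k+1}-z^k\|^{\frac1\theta}\big\},$$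 and suppose that there exist $\widetilde{k}_0\in\mathbb{N}$, $\widetilde{\gamma}>0$ and $\widetilde{\tau}\in(0,1)$ such that for all $k\ge\widetilde{k}_0$, $$\sum_{j\in K_2\cup K_{31},\,j\ge k}\sqrt{H_\delta(z^{\ell(j+1)})-H_\delta(z^{j+1})}\le\begin{cases}\widetilde{\gamma}\,\widetilde{\tau}^k&\text{if }\theta=1/2,\\ \widetilde{\gamma}\,k^{\frac{1-\theta}{1-2\theta}}&\text{if }\theta\in(1/2,1).\end{cases}$$ Then $\{z^k\}_{k\in\mathbb{N}}$ converges to some $\widetilde{z}\in\mathrm{crit}\,H_\delta$ and there exist $\overline{k}\in\mathbb{N}$, $\gamma>0$ and $\varrho\in(0,1)$ such that for all $k\ge\overline{k}$ $$\|z^k-\widetilde{z}\|\le\sum_{j=k}^\infty\|z^{j+1}-z^j\|\le\begin{cases}\gamma\varrho^k&\text{if }\theta=1/2,\\ \gamma k^{\frac{1-\theta}{1-2\theta}}&\text{if }\theta\in(1/2,1).\end{cases}$$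
   Context: $f$ is $L_f$-smooth: differentiable with $L_f$-Lipschitz gradient. $\partial$ is the limiting (Mordukhovich) subdifferential and $\mathrm{crit}\,h:=\{x\,|\,0\in\partial h(x)\}$. For $\tau>0$, $\mathcal{P}_\tau g(x):=\arg\min_{z}\{\frac{1}{2\tau}\|z-x\|^2+g(z)\}$. For $\delta>0$ and $z=(x,u)\in\mathbb{X}\times\mathbb{X}$, $H_\delta(z):=F(x)+\frac{\delta}{2}\|x-u\|^2$. $\mathbb{X}\times\mathbb{X}$ carries the product Euclidean norm. $[t]_+:=\max(0,t)$. KL: for $\eta\in(0,\infty]$, let $\Upsilon_\eta$ be the family of continuous concave $\varphi:[0,\eta)\to\mathbb{R}_+$ that are $C^1$ on $(0,\eta)$ with $\varphi'>0$ there and $\varphi(0)=0$. A proper lsc $h$ has the KL property at $\overline{x}\in\mathrm{dom}\,\partial h$ if there exist $\eta\in(0,\infty]$, a neighborhood $\mathcal{U}$ of $\overline{x}$ and $\varphi\in\Upsilon_\eta$ with $\varphi'(h(x)-h(\overline{x}))\,\mathrm{dist}(0,\partial h(x))\ge1$ for all $x\in\mathcal{U}$ with $h(\overline{x})<h(x)<h(\overline{x})+\eta$; it has the KL property of exponent $\theta\in[0,1)$ at $\overline{x}$ if $\varphi$ can be chosen as $\varphi(t)=ct^{1-\theta}$ for some $c>0$. $h$ is a KL function (of exponent $\theta$) if this holds at every point of $\mathrm{dom}\,\partial h$. PGenls algorithm (nonmonotone line search proximal gradient with extrapolation). Parameters: $m\in\mathbb{N}$ (integer $\ge0$), $\delta\in(0,1/2)$,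 $0<\alpha<\delta/2$, $0<\tau_{\min}\le\frac{1}{2(\alpha+\delta)+L_f}<\tau_{\max}$, $\beta_{\max}\ge0$, $\eta_1,\eta_2\in(0,1)$. Start: $x^0\in\mathrm{dom}\,g$, $x^{-1}=x^0$, $z^0=(x^0,x^{-1})$. Iteration $k=0,1,2,\ldots$ (run indefinitely): choose any $\beta_{k,0}\in[0,\beta_{\max}]$ and $\tau_{k,0}\in[\tau_{\min},\tau_{\max}]$; for $l=0,1,2,\ldots$ set $\beta_k=\beta_{k,0}\eta_1^l$, $\tau_k=\max\{\tau_{k,0}\eta_2^l,\tau_{\min}\}$, $y^k=x^k+\beta_k(x^k-x^{k-1})$, pick $x^{k+1}\in\mathcal{P}_{\tau_k}g(y^k-\tau_k\nabla f(y^k))$, $z^{k+1}=(x^{k+1},x^k)$, and stop the inner loop (accepting $x^{k+1}$) as soon as $H_\delta(z^{k+1})\le\max_{j=[k-m]_+,\ldots,k}H_\delta(z^j)-\frac{\alpha}{2}\|z^{k+1}-z^k\|^2$. $\ell(k)$ denotes the largest index in $\arg\max_{j=[k-m]_+,\ldots,k}H_\delta(z^j)$. Convention: the quotient with denominator $\|z^{k+1}-z^k\|^2$ is read as $+\infty$ when $z^{k+1}=z^k$, and a liminf over a finite index set is $+\infty$. *)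

theory Defs
  imports "HOL-Analysis.Analysis"
begin

section \<open>Extended-real-valued functions\<close>

definition dom :: "('a \<Rightarrow> ereal) \<Rightarrow> 'a set" where
  "dom h = {x. h x < \<infinity>}"

definition proper_fun :: "('a \<Rightarrow> ereal) \<Rightarrow> bool" where
  "proper_fun h \<longleftrightarrow> (\<forall>x. h x \<noteq> -\<infinity>) \<and> dom h \<noteq> {}"

definition lower_semicont :: "('a::topological_space \<Rightarrow> ereal) \<Rightarrow> bool" where
  "lower_semicont h \<longleftrightarrow> (\<forall>x. h x \<le> Liminf (at x) h)"

definition bounded_below_fun :: "('a \<Rightarrow> ereal) \<Rightarrow> bool" where
  "bounded_below_fun h \<longleftrightarrow> (\<exists>b::real. \<forall>x. ereal b \<le> h x)"

definition coercive :: "('a::real_normed_vector \<Rightarrow> ereal) \<Rightarrow> bool" where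
  "coercive h \<longleftrightarrow> (h \<longlongrightarrow> \<infinity>) at_infinity"

section \<open>Smooth functions\<close>

text \<open>\<open>GDERIV\<close> determines the gradient uniquely, so \<open>grad f x\<close> is the gradient wherever
  \<open>f\<close> is differentiable.\<close>

definition grad :: "('a::real_inner \<Rightarrow> real) \<Rightarrow> 'a \<Rightarrow> 'a" where
  "grad f x = (THE v. GDERIV f x :> v)"

definition smooth_with :: "real \<Rightarrow> ('a::real_inner \<Rightarrow> real) \<Rightarrow> bool" where
  "smooth_with L f \<longleftrightarrow> (\<forall>x. f differentiable at x) \<and> L-lipschitz_on UNIV (grad f)"

section \<open>Subdifferentials\<close>

text \<open>Both subdifferentials are empty at points where \<open>h\<close> is not finite.\<close>

definition regular_subdiff :: "('a::real_inner \<Rightarrow> ereal) \<Rightarrow> 'a \<Rightarrow> 'a set" where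
  "regular_subdiff h x = {v. \<bar>h x\<bar> \<noteq> \<infinity> \<and>
     0 \<le> Liminf (at x) (\<lambda>y. (h y - h x - ereal (v \<bullet> (y - x))) / ereal (norm (y - x)))}"

definition limiting_subdiff :: "('a::real_inner \<Rightarrow> ereal) \<Rightarrow> 'a \<Rightarrow> 'a set" where
  "limiting_subdiff h x = {v. \<bar>h x\<bar> \<noteq> \<infinity> \<and>
     (\<exists>(xs :: nat \<Rightarrow> 'a) vs. xs \<longlonglongrightarrow> x \<and> (\<lambda>n. h (xs n)) \<longlonglongrightarrow> h x \<and>
        (\<forall>n. vs n \<in> regular_subdiff h (xs n)) \<and> vs \<longlonglongrightarrow> v)}"

definition dom_subdiff :: "('a::real_inner \<Rightarrow> ereal) \<Rightarrow> 'a set" where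
  "dom_subdiff h = {x. limiting_subdiff h x \<noteq> {}}"

definition crit :: "('a::real_inner \<Rightarrow> ereal) \<Rightarrow> 'a set" where
  "crit h = {x. 0 \<in> limiting_subdiff h x}"

text \<open>Distance of the origin to a set, with value \<open>\<infinity>\<close> for the empty set; the library's
  \<open>infdist\<close> and \<open>setdist\<close> return 0 there.\<close>

definition dist_zero :: "'a::real_normed_vector set \<Rightarrow> ereal" where
  "dist_zero S = (INF v\<in>S. ereal (norm v))"

section \<open>The Kurdyka-Lojasiewicz property\<close>

definition desingularizing :: "ereal \<Rightarrow> (real \<Rightarrow> real) set" where
  "desingularizing \<eta> = {\<phi>.
     continuous_on {t. 0 \<le> t \<and> ereal t < \<eta>} \<phi> \<and>
     concave_on {t. 0 \<le> t \<and> ereal t < \<eta>} \<phi> \<and>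
     (\<forall>t. 0 \<le> t \<and> ereal t < \<eta> \<longrightarrow> 0 \<le> \<phi> t) \<and>
     (\<forall>t. 0 < t \<and> ereal t < \<eta> \<longrightarrow> \<phi> differentiable at t \<and> 0 < deriv \<phi> t) \<and>
     continuous_on {t. 0 < t \<and> ereal t < \<eta>} (deriv \<phi>) \<and>
     \<phi> 0 = 0}"

definition KL_inequality ::
  "('a::real_inner \<Rightarrow> ereal) \<Rightarrow> 'a \<Rightarrow> ereal \<Rightarrow> 'a set \<Rightarrow> (real \<Rightarrow> real) \<Rightarrow> bool" where
  "KL_inequality h xb \<eta> U \<phi> \<longleftrightarrow>
     (\<forall>x\<in>U. h xb < h x \<and> h x < h xb + \<eta> \<longrightarrow>
        1 \<le> ereal (deriv \<phi> (real_of_ereal (h x - h xb))) * dist_zero (limiting_subdiff h x))"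

definition KL_at :: "('a::real_inner \<Rightarrow> ereal) \<Rightarrow> 'a \<Rightarrow> bool" where
  "KL_at h xb \<longleftrightarrow> (\<exists>\<eta>>0. \<exists>U. \<exists>\<phi>\<in>desingularizing \<eta>.
     open U \<and> xb \<in> U \<and> KL_inequality h xb \<eta> U \<phi>)"

definition KL_exponent_at :: "real \<Rightarrow> ('a::real_inner \<Rightarrow> ereal) \<Rightarrow> 'a \<Rightarrow> bool" where
  "KL_exponent_at \<theta> h xb \<longleftrightarrow> (\<exists>\<eta>>0. \<exists>U. \<exists>\<phi>\<in>desingularizing \<eta>.
     open U \<and> xb \<in> U \<and> KL_inequality h xb \<eta> U \<phi> \<and>
     (\<exists>c>0. \<forall>t. 0 \<le> t \<and> ereal t < \<eta> \<longrightarrow> \<phi> t = c * t powr (1 - \<theta>)))"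

definition KL_function :: "('a::real_inner \<Rightarrow> ereal) \<Rightarrow> bool" where
  "KL_function h \<longleftrightarrow> (\<forall>xb\<in>dom_subdiff h. KL_at h xb)"

definition KL_function_exponent :: "real \<Rightarrow> ('a::real_inner \<Rightarrow> ereal) \<Rightarrow> bool" where
  "KL_function_exponent \<theta> h \<longleftrightarrow> (\<forall>xb\<in>dom_subdiff h. KL_exponent_at \<theta> h xb)"

section \<open>The algorithm\<close>

definition prox :: "real \<Rightarrow> ('a::real_inner \<Rightarrow> ereal) \<Rightarrow> 'a \<Rightarrow> 'a set" where
  "prox \<tau> g x = {z. is_arg_min (\<lambda>z. ereal (1 / (2 * \<tau>) * (norm (z - x))\<^sup>2) + g z) (\<lambda>_. True) z}"

definition H :: "real \<Rightarrow> ('a::real_inner \<Rightarrow> ereal) \<Rightarrow> 'a \<times> 'a \<Rightarrow> ereal" where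
  "H \<delta> F = (\<lambda>(x, u). F x + ereal (\<delta> / 2 * (norm (x - u))\<^sup>2))"

text \<open>Truncated subtraction on the naturals encodes two conventions: \<open>x (k - 1)\<close> is \<open>x 0\<close> for
  \<open>k = 0\<close>, which is the choice of the \<open>-1\<close>-st iterate, and \<open>{k - m..k}\<close> starts at the positive
  part of the integer \<open>k - m\<close>.\<close>

definition zseq :: "(nat \<Rightarrow> 'a) \<Rightarrow> nat \<Rightarrow> 'a \<times> 'a" where
  "zseq x k = (x k, x (k - 1))"

definition extrap :: "(nat \<Rightarrow> 'a::real_vector) \<Rightarrow> nat \<Rightarrow> real \<Rightarrow> 'a" where
  "extrap x k \<beta> = x k + \<beta> *\<^sub>R (x k - x (k - 1))"

definition accepted ::
  "(('a::real_inner) \<Rightarrow> ereal) \<Rightarrow> nat \<Rightarrow> real \<Rightarrow> real \<Rightarrow> (nat \<Rightarrow> 'a) \<Rightarrow> nat \<Rightarrow> 'a \<Rightarrow> bool" where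
  "accepted F m \<delta> \<alpha> x k w \<longleftrightarrow>
     H \<delta> F (w, x k) \<le> Max ((\<lambda>j. H \<delta> F (zseq x j)) ` {k - m..k})
       - ereal (\<alpha> / 2 * (norm ((w, x k) - zseq x k))\<^sup>2)"

text \<open>\<open>PGenls_run \<dots> x\<close>: the sequence \<open>x\<close> can be produced by the algorithm. In iteration \<open>k\<close>,
  \<open>w l\<close> is the trial point of the \<open>l\<close>-th inner step and \<open>n\<close> is the first inner step whose
  trial point is accepted.\<close>

definition PGenls_run ::
  "('a::real_inner \<Rightarrow> real) \<Rightarrow> ('a \<Rightarrow> ereal) \<Rightarrow> nat \<Rightarrow> real \<Rightarrow> real \<Rightarrow> real \<Rightarrow> real \<Rightarrow> real \<Rightarrow>
   real \<Rightarrow> real \<Rightarrow> (nat \<Rightarrow> 'a) \<Rightarrow> bool" where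
  "PGenls_run f g m \<delta> \<alpha> \<tau>min \<tau>max \<beta>max \<eta>1 \<eta>2 x \<longleftrightarrow>
     x 0 \<in> dom g \<and>
     (\<forall>k. \<exists>\<beta>0\<in>{0..\<beta>max}. \<exists>\<tau>0\<in>{\<tau>min..\<tau>max}. \<exists>n w.
        (\<forall>l\<le>n. let \<beta> = \<beta>0 * \<eta>1 ^ l; \<tau> = max (\<tau>0 * \<eta>2 ^ l) \<tau>min; y = extrap x k \<beta>
               in w l \<in> prox \<tau> g (y - \<tau> *\<^sub>R grad f y)) \<and>
        (\<forall>l<n. \<not> accepted (\<lambda>v. ereal (f v) + g v) m \<delta> \<alpha> x k (w l)) \<and>
        accepted (\<lambda>v. ereal (f v) + g v) m \<delta> \<alpha> x k (w n) \<and>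
        x (Suc k) = w n)"

section \<open>Quantities attached to a run\<close>

definition ell :: "('a::real_inner \<Rightarrow> ereal) \<Rightarrow> nat \<Rightarrow> real \<Rightarrow> (nat \<Rightarrow> 'a) \<Rightarrow> nat \<Rightarrow> nat" where
  "ell F m \<delta> x k = Max {j. is_arg_max (\<lambda>j. H \<delta> F (zseq x j)) (\<lambda>j. j \<in> {k - m..k}) j}"

text \<open>All iterates of a run lie in the domain of \<open>g\<close>, so the values below are finite and nothing
  is lost in the conversion to a real number.\<close>

definition Hval :: "('a::real_inner \<Rightarrow> ereal) \<Rightarrow> real \<Rightarrow> (nat \<Rightarrow> 'a) \<Rightarrow> nat \<Rightarrow> real" where
  "Hval F \<delta> x k = real_of_ereal (H \<delta> F (zseq x k))"

definition gap :: "('a::real_inner \<Rightarrow> ereal) \<Rightarrow> nat \<Rightarrow> real \<Rightarrow> (nat \<Rightarrow> 'a) \<Rightarrow> nat \<Rightarrow> real" where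
  "gap F m \<delta> x k = Hval F \<delta> x (ell F m \<delta> x (k + 1)) - Hval F \<delta> x (k + 1)"

definition step :: "(nat \<Rightarrow> 'a::real_inner) \<Rightarrow> nat \<Rightarrow> real" where
  "step x k = norm (zseq x (k + 1) - zseq x k)"

definition K1 :: "('a::real_inner \<Rightarrow> ereal) \<Rightarrow> nat \<Rightarrow> real \<Rightarrow> real \<Rightarrow> (nat \<Rightarrow> 'a) \<Rightarrow> nat set" where
  "K1 F m \<delta> \<alpha> x = {k. gap F m \<delta> x k \<ge> \<alpha> / 4 * (step x k)\<^sup>2}"

definition K2 ::
  "('a::real_inner \<Rightarrow> ereal) \<Rightarrow> nat \<Rightarrow> real \<Rightarrow> real \<Rightarrow> real \<Rightarrow> (nat \<Rightarrow> 'a) \<Rightarrow> nat set" where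
  "K2 F m \<delta> \<alpha> \<theta> x = {k. \<alpha> / 4 * (step x k)\<^sup>2 \<le> gap F m \<delta> x k \<and>
                        gap F m \<delta> x k < \<alpha> / 4 * step x k powr (1 / \<theta>)}"

definition K31 ::
  "('a::real_inner \<Rightarrow> ereal) \<Rightarrow> nat \<Rightarrow> real \<Rightarrow> real \<Rightarrow> real \<Rightarrow> (nat \<Rightarrow> 'a) \<Rightarrow> nat set" where
  "K31 F m \<delta> \<alpha> \<theta> x = {k \<in> K1 F m \<delta> \<alpha> x - K2 F m \<delta> \<alpha> \<theta> x.
     lim (Hval F \<delta> x) - Hval F \<delta> x (k + 1) > \<alpha> / 8 * step x k powr (1 / \<theta>)}"

definition decrease_ratio ::
  "('a::real_inner \<Rightarrow> ereal) \<Rightarrow> nat \<Rightarrow> real \<Rightarrow> (nat \<Rightarrow> 'a) \<Rightarrow> nat \<Rightarrow> ereal" where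
  "decrease_ratio F m \<delta> x k =
     (if zseq x (k + 1) = zseq x k then \<infinity>
      else ereal ((Hval F \<delta> x (ell F m \<delta> x k) - Hval F \<delta> x (ell F m \<delta> x (k + 1))) / (step x k)\<^sup>2))"

text \<open>The limit inferior of \<open>q k\<close> as \<open>k\<close> tends to infinity within \<open>K\<close>. For finite \<open>K\<close> the filter
  is trivial and the value is \<open>\<infinity>\<close>.\<close>

definition liminf_on :: "nat set \<Rightarrow> (nat \<Rightarrow> ereal) \<Rightarrow> ereal" where
  "liminf_on K q = Liminf (inf sequentially (principal K)) q"

text \<open>For \<open>\<theta> > 1/2\<close> the exponent is negative, and \<open>0 powr a\<close> is 0 rather than \<open>\<infinity>\<close>. Bounds by
  \<open>rate\<close> are only ever asserted for all \<open>k\<close> from some index on, which may be taken positive, so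
  the value at \<open>k = 0\<close> is immaterial.\<close>

definition rate :: "real \<Rightarrow> real \<Rightarrow> real \<Rightarrow> nat \<Rightarrow> real" where
  "rate \<theta> \<gamma> \<tau> k = (if \<theta> = 1/2 then \<gamma> * \<tau> ^ k else \<gamma> * real k powr ((1 - \<theta>) / (1 - 2 * \<theta>)))"

end

theory Submission
  imports Defs
begin

text \<open>
  The proximal step makes \<open>F\<close> lie above a concave quadratic that touches it at \<open>x\<^sub>k\<^sub>+\<^sub>1\<close>, with a slope of
  norm \<open>O(d\<^sub>k)\<close>, where \<open>d\<^sub>k = \<parallel>z\<^sub>k\<^sub>+\<^sub>1 - z\<^sub>k\<parallel>\<close>. Evaluated at \<open>x\<^sub>k\<close>, this bounds a possible increase
  of \<open>h\<^sub>k = H(z\<^sub>k)\<close> in one step by \<open>O(d\<^sub>k\<^sup>2)\<close>. Together with the line search, which gives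
  \<open>h\<^sub>k\<^sub>+\<^sub>1 + a d\<^sub>k\<^sup>2 \<le> M\<^sub>k\<close> for the window maximum \<open>M\<^sub>k\<close>, it shows that \<open>d\<^sub>k\<^sup>2\<close> is at most a multiple of
  \<open>M\<^sub>k - M\<^sub>k\<^sub>+\<^sub>m\<^sub>+\<^sub>1\<close>. So no step is long compared to the decrease of the window maximum, and the
  KL inequality at the index attaining \<open>M\<^sub>k\<close> gives finite length and the rates as in the monotone
  case.
\<close>

section \<open>Rates for recursive inequalities\<close>

text \<open>The KL inequality says nothing at indices with \<open>h k \<le> \<omega>\<close>, which
  a nonmonotone run may visit, whereas window maxima never fall below their limit \<omega>. The
  price of working at the maximizing index is that the subgradient there is bounded by an earlier
  step, at an unknown position among the last m + 1. Each step is therefore compared with the sum of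
  the m + 1 preceding ones, weighted by 1 / (2 * (m + 1)): every step occurs in at most m + 1 such
  windows, so after summation half of the sum can be absorbed.

  The KL property is assumed for \<open>F\<close>, while the descent concerns \<open>H\<close>.
  Where the quadratic term makes up most of the excess of \<open>H\<close> over \<omega>, the step
  dominates the square root of that excess, and a power with exponent \<kappa> \<le> 1/2
  desingularizes. For \<theta> \<ge> 1/2 the choice \<kappa> = 1 - \<theta> is admissible, so the
  exponent of \<open>F\<close> survives. Without a given exponent \<kappa> = 1/2 is taken, and
  compactness merges the desingularizing functions at all cluster points into one.\<close>

lemma geometric_rate:
  fixes a :: "nat \<Rightarrow> real"
  assumes nonneg: "\<And>k. 0 \<le> a k" and dec: "\<And>i j. i \<le> j \<Longrightarrow> a j \<le> a i"
    and p: "0 < p" and C: "0 < C"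
    and rec: "\<And>k. k0 \<le> k \<Longrightarrow> a (k + p) \<le> C * (a k - a (k + p))"
  obtains \<gamma> \<rho> where "0 < \<gamma>" "0 < \<rho>" "\<rho> < 1" "\<And>k. k0 \<le> k \<Longrightarrow> a k \<le> \<gamma> * \<rho> ^ k"
proof -
  define \<rho>0 where "\<rho>0 = C / (1 + C)"
  define \<rho> where "\<rho> = root p \<rho>0"
  have \<rho>0: "0 < \<rho>0" "\<rho>0 < 1" using C by (auto simp: \<rho>0_def)
  have \<rho>: "0 < \<rho>" "\<rho> < 1" "\<rho> ^ p = \<rho>0"
    using \<rho>0 p by (auto simp: \<rho>_def)
  \<comment> \<open>Large enough for the whole initial block of \<open>p\<close> indices, since
    \<rho> < 1; the summand 1 keeps \<gamma> positive when \<open>a k0 = 0\<close>. From there the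
    induction advances by \<open>p\<close>, with factor \<open>\<rho> ^ p = \<rho>0\<close>.\<close>
  define \<gamma> where "\<gamma> = (a k0 + 1) / \<rho> ^ (k0 + p)"
  have \<gamma>: "0 < \<gamma>" using nonneg[of k0] \<rho> by (auto simp: \<gamma>_def add_nonneg_pos)
  have "a k \<le> \<gamma> * \<rho> ^ k" if "k0 \<le> k" for k
    using that
  proof (induction k rule: less_induct)
    case (less k)
    show ?case
    proof (cases "k < k0 + p")
      case True
      have "a k \<le> a k0 + 1" using dec[OF less.prems] by simp
      also have "\<dots> = \<gamma> * \<rho> ^ (k0 + p)" using \<rho> by (simp add: \<gamma>_def)
      also have "\<dots> \<le> \<gamma> * \<rho> ^ k"
        using \<rho> \<gamma> True by (intro mult_left_mono power_decreasing) auto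
      finally show ?thesis .
    next
      case False
      define j where "j = k - p"
      have j: "k = j + p" "k0 \<le> j" "j < k" using False p by (auto simp: j_def)
      have "a (j + p) * (1 + C) \<le> C * a j" using rec[OF j(2)] by (simp add: algebra_simps)
      then have "a k \<le> \<rho>0 * a j" using C by (simp add: \<rho>0_def j(1) field_simps)
      also have "\<dots> \<le> \<rho>0 * (\<gamma> * \<rho> ^ j)"
        using less.IH[OF j(3,2)] \<rho>0 by (intro mult_left_mono) auto
      also have "\<dots> = \<gamma> * \<rho> ^ k" by (simp add: j(1) power_add \<rho>(3))
      finally show ?thesis .
    qed
  qed
  then show ?thesis using that \<gamma> \<rho> by blast
qed

text \<open>The convex function \<open>y powr (-q)\<close> lies above its tangent at
  \<open>x\<close>. This follows from \<open>ln (1 + t) \<le> t\<close> and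
  \<open>1 + t \<le> exp t\<close>.\<close>

lemma powr_neg_shift_diff:
  fixes x p q :: real
  assumes "0 < x" "0 \<le> p" "0 \<le> q"
  shows "x powr (-q) - (x + p) powr (-q) \<le> q * p * x powr (- q - 1)"
proof -
  have "1 - q * (p / x) \<le> 1 - q * ln (1 + p / x)"
    using assms mult_left_mono[OF ln_add_one_self_le_self[of "p / x"], of q] by simp
  also have "\<dots> \<le> exp (- q * ln (1 + p / x))"
    using exp_ge_add_one_self[of "- q * ln (1 + p / x)"] by simp
  also have "\<dots> = (1 + p / x) powr (- q)"
    using add_pos_nonneg[of 1 "p / x"] assms by (simp add: powr_def)
  finally have "x powr (-q) * (1 - q * (p / x)) \<le> x powr (-q) * (1 + p / x) powr (- q)"
    by (intro mult_left_mono) auto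
  also have "\<dots> = (x * (1 + p / x)) powr (- q)"
    using assms by (intro powr_mult[symmetric])
  also have "x * (1 + p / x) = x + p" using assms by (simp add: field_simps)
  finally have "x powr (-q) - (x + p) powr (-q) \<le> q * p * (x powr (-q) / x)"
    by (simp add: algebra_simps)
  also have "x powr (-q) / x = x powr (- q - 1)"
    using assms by (simp add: powr_diff)
  finally show ?thesis .
qed

text \<open>The comparison sequence is \<open>\<gamma> * real k powr (- q)\<close> with
  \<open>q * s = q + 1\<close>, so that its power \<open>s\<close> has the order of its own
  decrements. If it bounds \<open>a\<close> at \<open>k - p\<close> but not at \<open>k\<close>, the
  recursion forces \<open>\<gamma> powr (s - 1) < B\<close>, against the choice of \<gamma>.\<close>

lemma sublinear_rate:
  fixes a :: "nat \<Rightarrow> real"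
  assumes nonneg: "\<And>k. 0 \<le> a k" and dec: "\<And>i j. i \<le> j \<Longrightarrow> a j \<le> a i"
    and s: "1 < s" and C: "0 < C"
    and rec: "\<And>k. k0 \<le> k \<Longrightarrow> a (k + p) powr s \<le> C * (a k - a (k + p))"
  obtains \<gamma> k1 where "0 < \<gamma>" "\<And>k. k1 \<le> k \<Longrightarrow> a k \<le> \<gamma> * real k powr (- 1 / (s - 1))"
proof -
  define q where "q = 1 / (s - 1)"
  have q: "0 < q" "q * s = q + 1" using s by (auto simp: q_def field_simps)
  \<comment> \<open>Index 0 is left out, because \<open>0 powr (- q)\<close> is 0.\<close>
  define k1 where "k1 = max k0 1"
  \<comment> \<open>The last factor comes from \<open>real k \<le> (1 + real p) * real j\<close> for
    \<open>k = j + p\<close> and \<open>j \<ge> 1\<close>, by which powers of \<open>k\<close> are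
    replaced by powers of \<open>j\<close>.\<close>
  define B where "B = C * q * real p * (1 + real p) powr (q + 1)"
  \<comment> \<open>The first entry covers the indices up to \<open>k1 + p\<close>, the second one
    yields the contradiction in the induction step.\<close>
  define \<gamma> where "\<gamma> = max ((a k1 + 1) * real (k1 + p) powr q) (B powr q)"
  have "1 \<le> real (k1 + p) powr q" using q by (auto simp: k1_def intro!: ge_one_powr_ge_zero)
  then have "1 * 1 \<le> (a k1 + 1) * real (k1 + p) powr q"
    using nonneg[of k1] by (intro mult_mono) auto
  then have \<gamma>: "0 < \<gamma>" by (auto simp: \<gamma>_def)
  have B: "0 \<le> B" using C q by (simp add: B_def)
  have "a k \<le> \<gamma> * real k powr (- q)" if "k1 \<le> k" for k
    using that
  proof (induction k rule: less_induct)
    case (less k)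
    have k: "0 < real k" using less.prems by (auto simp: k1_def)
    show ?case
    proof (cases "k \<le> k1 + p")
      case True
      have "a k \<le> (a k1 + 1) * 1" using dec[OF less.prems] by simp
      also have "\<dots> = (a k1 + 1) * (real k powr q * real k powr (- q))"
        using k by (simp add: powr_minus)
      also have "\<dots> = ((a k1 + 1) * real k powr q) * real k powr (- q)" by simp
      also have "\<dots> \<le> ((a k1 + 1) * real (k1 + p) powr q) * real k powr (- q)"
        using True nonneg[of k1] q by (intro mult_right_mono mult_left_mono powr_mono2) auto
      also have "\<dots> \<le> \<gamma> * real k powr (- q)"
        by (intro mult_right_mono) (auto simp: \<gamma>_def)
      finally show ?thesis .
    next
      case False
      define j where "j = k - p"
      have j: "k = j + p" "k0 \<le> j" "k1 \<le> j" "1 \<le> j" using False by (auto simp: j_def k1_def)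
      show ?thesis
      proof (rule ccontr)
        assume not: "\<not> ?thesis"
        have p: "0 < p"
        proof (rule ccontr)
          assume "\<not> 0 < p"
          then have "a k powr s \<le> 0" using rec[OF j(2)] j(1) by simp
          moreover have "0 < a k" using not \<gamma> k
            by (metis linorder_not_le order_le_less_trans zero_less_mult_iff powr_gt_zero less_eq_real_def mult_nonneg_nonneg)
          ultimately show False by simp
        qed
        have IH: "a j \<le> \<gamma> * real j powr (- q)" using less.IH[of j] j p by simp
        have "- q * s = - q - 1" using q by simp
        then have pw: "(\<gamma> * real k powr (- q)) powr s = \<gamma> powr s * real k powr (- q - 1)"
          using \<gamma> by (simp only: powr_mult powr_powr)
        have "(\<gamma> * real k powr (- q)) powr s < a k powr s"
          using not \<gamma> s by (intro powr_less_mono2) auto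
        also have "\<dots> \<le> C * (a j - a k)" using rec[OF j(2)] j(1) by simp
        also have "\<dots> \<le> C * (\<gamma> * (real j powr (- q) - (real j + real p) powr (- q)))"
          using IH not C j(1) by (intro mult_left_mono) (auto simp: algebra_simps)
        also have "\<dots> \<le> C * (\<gamma> * (q * real p * real j powr (- q - 1)))"
          using C \<gamma> q j(4) by (intro mult_left_mono powr_neg_shift_diff) auto
        finally have *: "\<gamma> powr s * real k powr (- q - 1) < C * q * real p * \<gamma> * real j powr (- q - 1)"
          by (simp add: pw algebra_simps)
        have "real k \<le> (1 + real p) * real j"
        proof -
          have "real p * 1 \<le> real p * real j" using j(4) by (intro mult_left_mono) auto
          then show ?thesis by (simp add: j(1) algebra_simps)
        qed
        then have "real k powr (q + 1) \<le> ((1 + real p) * real j) powr (q + 1)"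
          using q by (intro powr_mono2) auto
        then have kj: "real k powr (q + 1) \<le> (1 + real p) powr (q + 1) * real j powr (q + 1)"
          by (simp add: powr_mult)
        have inv: "y powr (- q - 1) * y powr (q + 1) = 1" if "0 < y" for y :: real
          using that by (simp flip: powr_add)
        have "\<gamma> powr s = \<gamma> powr s * real k powr (- q - 1) * real k powr (q + 1)"
          using inv[OF k] by (simp add: mult.assoc)
        also have "\<dots> < C * q * real p * \<gamma> * real j powr (- q - 1) * real k powr (q + 1)"
          using * k by (intro mult_strict_right_mono) auto
        also have "\<dots> \<le> C * q * real p * \<gamma> * real j powr (- q - 1) * ((1 + real p) powr (q + 1) * real j powr (q + 1))"
          using kj C q \<gamma> by (intro mult_left_mono) auto
        also have "\<dots> = B * \<gamma> * (real j powr (- q - 1) * real j powr (q + 1))"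
          by (simp add: B_def algebra_simps)
        also have "\<dots> = B * \<gamma>" using inv[of "real j"] j(4) by simp
        finally have "\<gamma> powr (s - 1) < B" using \<gamma> by (simp add: powr_diff field_simps)
        then have "(\<gamma> powr (s - 1)) powr q < B powr q"
          using q by (intro powr_less_mono2) auto
        moreover have "(\<gamma> powr (s - 1)) powr q = \<gamma>"
          using \<gamma> s by (simp add: powr_powr q_def)
        ultimately show False by (simp add: \<gamma>_def)
      qed
    qed
  qed
  then show ?thesis using that[OF \<gamma>, of k1] by (simp add: q_def)
qed

section \<open>Nonmonotone descent of real sequences\<close>

text \<open>A difference with stride \<open>p\<close> is the decrement of the sum over a block of
  \<open>p\<close> consecutive values, hence it telescopes.\<close>

lemma sum_shift_diff:
  fixes P :: "nat \<Rightarrow> real"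
  assumes "K \<le> N"
  shows "(\<Sum>k\<in>{K..<N}. P k - P (k + p)) = (\<Sum>i<p. P (K + i) - P (N + i))"
  using assms
proof (induction N rule: dec_induct)
  case (step N)
  have "P N - P (N + p) = (\<Sum>i<p. P (N + i) - P (N + Suc i))"
    by (induction p) auto
  then have "(\<Sum>k\<in>{K..<Suc N}. P k - P (k + p)) =
      (\<Sum>i<p. P (K + i) - P (N + i)) + (\<Sum>i<p. P (N + i) - P (N + Suc i))"
    using step by simp
  then show ?case by (simp flip: sum.distrib)
qed simp

text \<open>Every index lies in at most \<open>p\<close> windows. With \<open>p \<le> K\<close> the
  subtraction \<open>k - p\<close> is not truncated, so for a fixed position in the window the
  indices are distinct.\<close>

lemma sum_sliding_window_le:
  fixes d :: "nat \<Rightarrow> real"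
  assumes "\<And>k. 0 \<le> d k" "p \<le> K"
  shows "(\<Sum>k\<in>{K..<N}. \<Sum>i\<in>{k - p..<k}. d i) \<le> real p * (\<Sum>i\<in>{K - p..<N}. d i)"
proof -
  have "(\<Sum>k\<in>{K..<N}. \<Sum>i\<in>{k - p..<k}. d i) = (\<Sum>k\<in>{K..<N}. \<Sum>i<p. d (k - p + i))"
  proof (rule sum.cong)
    fix k assume "k \<in> {K..<N}"
    then have "k - p + p = k" using assms(2) by auto
    then show "(\<Sum>i\<in>{k - p..<k}. d i) = (\<Sum>i<p. d (k - p + i))"
      using sum.shift_bounds_nat_ivl[of d 0 "k - p" p]
      by (simp add: atLeast0LessThan add.commute)
  qed simp
  also have "\<dots> = (\<Sum>i<p. \<Sum>k\<in>{K..<N}. d (k - p + i))" by (rule sum.swap)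
  also have "\<dots> \<le> (\<Sum>i<p. \<Sum>i\<in>{K - p..<N}. d i)"
  proof (rule sum_mono)
    fix i assume i: "i \<in> {..<p}"
    have "(\<Sum>k\<in>{K..<N}. d (k - p + i)) = sum d ((\<lambda>k. k - p + i) ` {K..<N})"
      using assms(2) by (subst sum.reindex) (auto simp: inj_on_def)
    also have "\<dots> \<le> (\<Sum>i\<in>{K - p..<N}. d i)"
      using assms i by (intro sum_mono2) auto
    finally show "(\<Sum>k\<in>{K..<N}. d (k - p + i)) \<le> (\<Sum>i\<in>{K - p..<N}. d i)" .
  qed
  also have "\<dots> = real p * (\<Sum>i\<in>{K - p..<N}. d i)" by simp
  finally show ?thesis .
qed

section \<open>Maxima over a sliding window\<close>

definition window_max :: "nat \<Rightarrow> (nat \<Rightarrow> 'b::linorder) \<Rightarrow> nat \<Rightarrow> 'b" where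
  "window_max m h k = Max (h ` {k - m..k})"

lemma window_max_ge: "j \<in> {k - m..k} \<Longrightarrow> h j \<le> window_max m h k"
  unfolding window_max_def by (rule Max_ge) auto

lemma window_max_attained:
  obtains j where "j \<in> {k - m..k}" "window_max m h k = h j"
proof -
  have "window_max m h k \<in> h ` {k - m..k}"
    unfolding window_max_def by (rule Max_in) auto
  then show ?thesis using that by auto
qed

lemma window_max_decreasing:
  assumes "\<And>k. h (Suc k) \<le> window_max m h k" "i \<le> j"
  shows "window_max m h j \<le> window_max m h i"
  using assms(2)
proof (induction j rule: dec_induct)
  case (step n)
  obtain l where l: "l \<in> {Suc n - m..Suc n}" "window_max m h (Suc n) = h l"
    by (rule window_max_attained)
  have "h l \<le> window_max m h n"
  proof (cases "l = Suc n")
    case False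
    then show ?thesis using l(1) by (intro window_max_ge) auto
  qed (use assms(1) in simp)
  then show ?case using l step.IH by simp
qed simp

text \<open>For concave \<open>\<psi>\<close> this is the KL inequality \<open>1 \<le> \<nu> * \<psi>' t\<close>. Unlike the latter it involves no
  derivative and is stable under adding monotone functions to \<open>\<psi>\<close>.\<close>

definition chord_bound :: "(real \<Rightarrow> real) \<Rightarrow> real \<Rightarrow> real \<Rightarrow> bool" where
  "chord_bound \<psi> \<nu> t \<longleftrightarrow> (\<forall>s u. 0 \<le> s \<longrightarrow> s \<le> u \<longrightarrow> u \<le> t \<longrightarrow> u - s \<le> \<nu> * (\<psi> u - \<psi> s))"

lemma chord_boundD: "chord_bound \<psi> \<nu> t \<Longrightarrow> 0 \<le> s \<Longrightarrow> s \<le> u \<Longrightarrow> u \<le> t \<Longrightarrow> u - s \<le> \<nu> * (\<psi> u - \<psi> s)"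
  by (auto simp: chord_bound_def)

text \<open>\<open>h\<close> stands for the values of \<open>H\<close> along a run and
  \<open>d\<close> for the step lengths. \<open>descent\<close> is the line search;
  \<open>ascent\<close> will come from the quadratic minorants of \<open>F\<close> and limits how
  far \<open>h\<close> can lie below the window maximum.\<close>

locale nonmonotone_descent =
  fixes h d :: "nat \<Rightarrow> real" and m :: nat and a C lb :: real
  assumes a: "0 < a" and C: "0 \<le> C" and d_nonneg: "\<And>k. 0 \<le> d k" and lb: "\<And>k. lb \<le> h k"
    and descent: "\<And>k. h (Suc k) + a * (d k)\<^sup>2 \<le> window_max m h k"
    and ascent: "\<And>k. h (Suc k) \<le> h k + C * (d k)\<^sup>2"
begin

abbreviation M where "M \<equiv> window_max m h"

definition q where "q = 1 + C / a"

definition Q where "Q = q ^ m / a"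

definition \<omega> where "\<omega> = lim h"

lemma q_ge_1: "1 \<le> q"
  using a C by (simp add: q_def)

lemma Q_pos: "0 < Q"
  using a q_ge_1 by (simp add: Q_def)

lemma M_decreasing: "i \<le> j \<Longrightarrow> M j \<le> M i"
proof (rule window_max_decreasing)
  fix k show "h (Suc k) \<le> M k" using descent[of k] a by (smt (verit) zero_le_power2 mult_nonneg_nonneg)
qed

lemma h_le_M: "h k \<le> M k"
  by (rule window_max_ge) simp

text \<open>A step can raise \<open>h\<close> by at most a multiple of its squared length, which in turn is bounded
  by the distance of the new value to the window maximum.\<close>

lemma backward_step:
  assumes "k \<le> j"
  shows "M k - h j \<le> q ^ i * (M k - h (j + i))"
proof (induction i)
  case (Suc i)
  have "a * (d (j + i))\<^sup>2 \<le> M k - h (Suc (j + i))"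
    using descent[of "j + i"] M_decreasing[of k "j + i"] assms by simp
  then have "C / a * (a * (d (j + i))\<^sup>2) \<le> C / a * (M k - h (Suc (j + i)))"
    using a C by (intro mult_left_mono) auto
  then have "M k - h (j + i) \<le> q * (M k - h (j + Suc i))"
    using ascent[of "j + i"] a by (simp add: q_def algebra_simps)
  then have "q ^ i * (M k - h (j + i)) \<le> q ^ i * (q * (M k - h (j + Suc i)))"
    using q_ge_1 by (intro mult_left_mono) auto
  then show ?case using Suc.IH by (simp add: algebra_simps)
qed simp

text \<open>The window of \<open>k + m\<close> starts exactly at \<open>k\<close>, so its maximum is
  attained at most \<open>m\<close> steps after \<open>k\<close>, and \<open>backward_step\<close>
  leads from there back to \<open>k\<close>.\<close>

lemma window_gap: "M k - h k \<le> q ^ m * (M k - M (k + m))"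
proof -
  obtain l where l: "l \<in> {k + m - m..k + m}" "M (k + m) = h l" by (rule window_max_attained)
  define i where "i = l - k"
  have i: "l = k + i" "i \<le> m" using l(1) by (auto simp: i_def)
  have "M k - h k \<le> q ^ i * (M k - M (k + m))" using backward_step[of k k i] l(2) i(1) by simp
  also have "\<dots> \<le> q ^ m * (M k - M (k + m))"
    using q_ge_1 i(2) M_decreasing[of k "k + m"] by (intro mult_right_mono power_increasing) auto
  finally show ?thesis .
qed

text \<open>The line search bounds the step by \<open>M k - h (Suc k)\<close>, which is split at
  \<open>M (Suc k)\<close>. \<open>window_gap\<close> treats the second part; since
  \<open>1 \<le> q ^ m\<close>, the first part can carry the same factor and the two
  combine.\<close>

lemma step_le_decrease: "(d k)\<^sup>2 \<le> Q * (M k - M (k + Suc m))"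
proof -
  have "a * (d k)\<^sup>2 \<le> 1 * (M k - M (Suc k)) + (M (Suc k) - h (Suc k))"
    using descent[of k] by simp
  also have "\<dots> \<le> q ^ m * (M k - M (Suc k)) + q ^ m * (M (Suc k) - M (Suc k + m))"
    using M_decreasing[of k "Suc k"] q_ge_1
    by (intro add_mono mult_right_mono window_gap) auto
  also have "\<dots> = q ^ m * (M k - M (k + Suc m))" by (simp add: algebra_simps)
  finally show ?thesis using a by (simp add: Q_def field_simps)
qed

text \<open>The window maxima decrease and are bounded below. \<open>window_gap\<close> squeezes
  \<open>h\<close> itself between two expressions in \<open>M\<close> with the same limit.\<close>

lemma limits: "h \<longlonglongrightarrow> \<omega>" "M \<longlonglongrightarrow> \<omega>" "d \<longlonglongrightarrow> 0" "\<omega> \<le> M k"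
proof -
  have "decseq M" using M_decreasing by (auto simp: decseq_def)
  moreover have "\<forall>i. lb \<le> M i" using lb h_le_M order_trans by blast
  ultimately obtain L where L: "M \<longlonglongrightarrow> L" "\<forall>i. L \<le> M i"
    by (rule decseq_convergent)
  have shift: "(\<lambda>k. M (k + n)) \<longlonglongrightarrow> L" for n using L(1) by (rule LIMSEQ_ignore_initial_segment)
  have "(\<lambda>k. M k - q ^ m * (M k - M (k + m))) \<longlonglongrightarrow> L - q ^ m * (L - L)"
    by (intro tendsto_intros L(1) shift)
  then have low: "(\<lambda>k. M k - q ^ m * (M k - M (k + m))) \<longlonglongrightarrow> L" by simp
  have "h \<longlonglongrightarrow> L"
  proof (rule tendsto_sandwich[OF _ _ low L(1)])
    show "\<forall>\<^sub>F k in sequentially. M k - q ^ m * (M k - M (k + m)) \<le> h k"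
    proof (rule always_eventually, rule allI)
      fix k show "M k - q ^ m * (M k - M (k + m)) \<le> h k" using window_gap[of k] by simp
    qed
  qed (use h_le_M in auto)
  moreover from this have "\<omega> = L" by (simp add: \<omega>_def limI)
  ultimately show "h \<longlonglongrightarrow> \<omega>" "M \<longlonglongrightarrow> \<omega>" "\<omega> \<le> M k" using L by auto
  have "(\<lambda>k. Q * (M k - M (k + Suc m))) \<longlonglongrightarrow> Q * (L - L)"
    by (intro tendsto_intros L(1) shift)
  then have "(\<lambda>k. Q * (M k - M (k + Suc m))) \<longlonglongrightarrow> 0" by simp
  then have "(\<lambda>k. (d k)\<^sup>2) \<longlonglongrightarrow> 0"
    by (rule tendsto_sandwich[rotated 3, where f = "\<lambda>_. 0"]) (use step_le_decrease in auto)
  then show "d \<longlonglongrightarrow> 0" by simp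
qed

text \<open>The chord bound at the index attaining \<open>M k\<close>, applied between the levels
  \<open>M (k + p)\<close> and \<open>M k\<close>, turns \<open>step_le_decrease\<close> into a
  bound of \<open>(d k)\<^sup>2\<close> by a multiple of \<open>d j * (P k - P (k + p))\<close> for
  some \<open>j\<close> in the preceding window. The inequality of the means separates the two
  factors; the second ones telescope, and the first ones are absorbed.\<close>

lemma tail_estimate:
  fixes \<psi> :: "real \<Rightarrow> real" and b \<eta> :: real
  assumes \<eta>: "0 < \<eta>" and b: "0 < b"
    and mono: "mono_on {0..<\<eta>} \<psi>" and \<psi>0: "0 \<le> \<psi> 0"
    and KL: "\<forall>\<^sub>F j in sequentially. \<omega> < h (Suc j) \<longrightarrow> chord_bound \<psi> (b * d j) (h (Suc j) - \<omega>)"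
  shows "summable d"
    and "\<exists>A>0. \<forall>\<^sub>F k in sequentially.
      (\<Sum>j. d (k + j)) \<le> (\<Sum>j\<in>{k - Suc m..<k}. d j) + A * \<psi> (M k - \<omega>)"
proof -
  have \<psi>: "\<psi> s \<le> \<psi> t" if "0 \<le> s" "s \<le> t" "t < \<eta>" for s t
    using mono_onD[OF mono, of s t] that by simp
  define p where "p = Suc m"
  define P where "P k = \<psi> (M k - \<omega>)" for k
  \<comment> \<open>Makes \<open>4 * (d j / (2 * real p)) * c\<close> equal to
    \<open>Q * b * d j\<close>, as needed for
    \<open>4 * x * y \<le> (x + y)\<^sup>2\<close>.\<close>
  define c where "c = real p * Q * b / 2"
  have p: "0 < real p" by (simp add: p_def)
  have c: "0 < c" using Q_pos b p by (simp add: c_def)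
  have "\<forall>\<^sub>F k in sequentially. M k < \<omega> + \<eta>"
    using limits(2) \<eta> by (intro order_tendstoD) auto
  with KL have "\<forall>\<^sub>F j in sequentially. M j < \<omega> + \<eta> \<and>
      (\<omega> < h (Suc j) \<longrightarrow> chord_bound \<psi> (b * d j) (h (Suc j) - \<omega>))"
    by eventually_elim simp
  then obtain K0 where K0: "\<And>j. K0 \<le> j \<Longrightarrow> M j < \<omega> + \<eta>"
      "\<And>j. K0 \<le> j \<Longrightarrow> \<omega> < h (Suc j) \<Longrightarrow> chord_bound \<psi> (b * d j) (h (Suc j) - \<omega>)"
    by (auto simp: eventually_sequentially)
  \<comment> \<open>For \<open>k \<ge> K\<close> the windows are not truncated, and the predecessor
    of the index attaining \<open>M k\<close> is still at least \<open>K0\<close>.\<close>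
  define K where "K = K0 + p"
  have P_dec: "P j \<le> P i" if "K \<le> i" "i \<le> j" for i j
    unfolding P_def using that limits(4)[of j] M_decreasing[of i j] K0(1)[of i]
    by (intro \<psi>) (auto simp: K_def)
  have P_nonneg: "0 \<le> P k" if "K \<le> k" for k
  proof -
    have "\<psi> 0 \<le> P k" unfolding P_def
      using that limits(4)[of k] K0(1)[of k] by (intro \<psi>) (auto simp: K_def)
    then show ?thesis using \<psi>0 by simp
  qed
  have S_nonneg: "0 \<le> (\<Sum>j\<in>{k - p..<k}. d j)" for k
    by (intro sum_nonneg d_nonneg)
  have step: "d k \<le> (\<Sum>j\<in>{k - p..<k}. d j) / (2 * real p) + c * (P k - P (k + p))"
    if k: "K \<le> k" for k
  proof (cases "\<omega> < M k")
    \<comment> \<open>\<open>M\<close> decreases to \<omega>, so it is constant from here on and the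
      step vanishes.\<close>
    case False
    have "M k - M (k + Suc m) \<le> 0" using False limits(4)[of "k + Suc m"] by simp
    then have "Q * (M k - M (k + Suc m)) \<le> 0" using Q_pos by (simp add: mult_le_0_iff)
    then have "(d k)\<^sup>2 \<le> 0" using step_le_decrease[of k] by linarith
    then have "d k = 0" by simp
    moreover have "0 \<le> c * (P k - P (k + p))" using c P_dec[OF k, of "k + p"] by simp
    ultimately show ?thesis using S_nonneg[of k] by simp
  next
    case True
    obtain l where l: "l \<in> {k - m..k}" "M k = h l" by (rule window_max_attained)
    define j where "j = l - 1"
    have j: "l = Suc j" "j \<in> {k - p..<k}" "K0 \<le> j" using l(1) k by (auto simp: j_def K_def p_def)
    have dj: "d j \<le> (\<Sum>j\<in>{k - p..<k}. d j)"
      using j(2) d_nonneg by (intro member_le_sum) auto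
    have "chord_bound \<psi> (b * d j) (M k - \<omega>)" using K0(2)[OF j(3)] True l(2) j(1) by simp
    from chord_boundD[OF this, of "M (k + p) - \<omega>" "M k - \<omega>"]
    have "M k - M (k + p) \<le> b * d j * (P k - P (k + p))"
      using limits(4) M_decreasing[of k "k + p"] by (simp add: P_def)
    then have "Q * (M k - M (k + p)) \<le> Q * (b * d j * (P k - P (k + p)))"
      using Q_pos by (intro mult_left_mono) auto
    then have "(d k)\<^sup>2 \<le> Q * (b * d j * (P k - P (k + p)))"
      using step_le_decrease[of k] by (simp add: p_def)
    also have "\<dots> = 4 * (d j / (2 * real p)) * (c * (P k - P (k + p)))"
      by (simp add: c_def p_def field_simps)
    also have "\<dots> \<le> (d j / (2 * real p) + c * (P k - P (k + p)))\<^sup>2"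
      using sum_squares_ge_zero[of "d j / (2 * real p) - c * (P k - P (k + p))" 0]
      by (simp add: power2_eq_square algebra_simps)
    finally have "d k \<le> d j / (2 * real p) + c * (P k - P (k + p))"
      by (rule power2_le_imp_le) (use c P_dec[OF k, of "k + p"] d_nonneg in auto)
    also have "\<dots> \<le> (\<Sum>j\<in>{k - p..<k}. d j) / (2 * real p) + c * (P k - P (k + p))"
      using dj by (intro add_right_mono divide_right_mono) auto
    finally show ?thesis .
  qed
  have partial: "(\<Sum>j\<in>{k..<N}. d j) \<le> (\<Sum>j\<in>{k - p..<k}. d j) + 2 * c * real p * P k"
    if k: "K \<le> k" and N: "k \<le> N" for k N
  proof -
    have "(\<Sum>j\<in>{k..<N}. d j)
        \<le> (\<Sum>i\<in>{k..<N}. (\<Sum>j\<in>{i - p..<i}. d j) / (2 * real p) + c * (P i - P (i + p)))"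
      using k by (intro sum_mono step) auto
    also have "\<dots> = (\<Sum>i\<in>{k..<N}. \<Sum>j\<in>{i - p..<i}. d j) / (2 * real p)
        + c * (\<Sum>i\<in>{k..<N}. P i - P (i + p))"
      by (simp add: sum.distrib sum_divide_distrib sum_distrib_left)
    also have "\<dots> \<le> (real p * (\<Sum>j\<in>{k - p..<N}. d j)) / (2 * real p) + c * (real p * P k)"
    proof (intro add_mono divide_right_mono mult_left_mono)
      show "(\<Sum>i\<in>{k..<N}. \<Sum>j\<in>{i - p..<i}. d j) \<le> real p * (\<Sum>j\<in>{k - p..<N}. d j)"
        using k d_nonneg by (intro sum_sliding_window_le) (auto simp: K_def)
      have "(\<Sum>i\<in>{k..<N}. P i - P (i + p)) = (\<Sum>i<p. P (k + i) - P (N + i))"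
        by (rule sum_shift_diff[OF N])
      also have "\<dots> \<le> (\<Sum>i<p. P k)"
      proof (rule sum_mono)
        fix i
        show "P (k + i) - P (N + i) \<le> P k"
          using P_dec[OF k, of "k + i"] P_nonneg[of "N + i"] k N by simp
      qed
      finally show "(\<Sum>i\<in>{k..<N}. P i - P (i + p)) \<le> real p * P k" by simp
    qed (use c in auto)
    also have "\<dots> = (\<Sum>j\<in>{k - p..<N}. d j) / 2 + c * real p * P k"
      using p by simp
    also have "(\<Sum>j\<in>{k - p..<N}. d j) = (\<Sum>j\<in>{k - p..<k}. d j) + (\<Sum>j\<in>{k..<N}. d j)"
      using N by (simp add: sum.atLeastLessThan_concat)
    finally have le: "(\<Sum>j\<in>{k..<N}. d j)
        \<le> ((\<Sum>j\<in>{k - p..<k}. d j) + (\<Sum>j\<in>{k..<N}. d j)) / 2 + c * real p * P k" .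
    \<comment> \<open>Half of the sum moves to the left. The sums stop at \<open>N\<close>, so this
      does not presuppose summability.\<close>
    have "x \<le> y + 2 * w" if "x \<le> (y + x) / 2 + w" for x y w :: real
      using that by (simp add: field_simps)
    from this[OF le] show ?thesis by (simp add: mult.assoc)
  qed
  have shifted: "(\<Sum>j<n. d (k + j)) \<le> (\<Sum>j\<in>{k - p..<k}. d j) + 2 * c * real p * P k"
    if "K \<le> k" for k n
    using partial[OF that, of "k + n"] sum.shift_bounds_nat_ivl[of d 0 k n]
    by (simp add: atLeast0LessThan add.commute)
  have sum_shift: "summable (\<lambda>j. d (k + j))" if "K \<le> k" for k
    using shifted[OF that] d_nonneg by (intro summableI_nonneg_bounded) auto
  from sum_shift[of K] show "summable d"
    using summable_iff_shift[of d K] by (simp add: add.commute)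
  have "\<forall>\<^sub>F k in sequentially.
      (\<Sum>j. d (k + j)) \<le> (\<Sum>j\<in>{k - Suc m..<k}. d j) + (2 * c * real p) * \<psi> (M k - \<omega>)"
    unfolding eventually_sequentially
    using shifted sum_shift by (intro exI[of _ K] allI impI suminf_le_const) (auto simp: p_def P_def)
  moreover have "0 < 2 * c * real p" using c by (simp add: p_def)
  ultimately show "\<exists>A>0. \<forall>\<^sub>F k in sequentially.
      (\<Sum>j. d (k + j)) \<le> (\<Sum>j\<in>{k - Suc m..<k}. d j) + A * \<psi> (M k - \<omega>)" by blast
qed

text \<open>At the index attaining \<open>M (k + p)\<close>, the chord bound down to 0 reads
  \<open>e powr \<theta> \<le> b * c * D\<close>, where \<open>D\<close> is both a window sum of
  steps and the decrement of the tail sums \<open>T\<close>. Inserted into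
  \<open>tail_estimate\<close> at \<open>k + p\<close>, it gives a recursion for \<open>T\<close>
  alone, to which the abstract rates apply.\<close>

lemma tail_rate:
  fixes \<theta> b c :: real
  assumes \<theta>: "1/2 \<le> \<theta>" "\<theta> < 1" and b: "0 < b" and c: "0 < c"
    and KL: "\<forall>\<^sub>F j in sequentially. \<omega> < h (Suc j) \<longrightarrow>
      chord_bound (\<lambda>t. c * t powr (1 - \<theta>)) (b * d j) (h (Suc j) - \<omega>)"
  shows "\<exists>kb. \<exists>\<gamma>>0. \<exists>\<rho>. 0 < \<rho> \<and> \<rho> < 1 \<and> (\<forall>k\<ge>kb. (\<Sum>j. d (k + j)) \<le> rate \<theta> \<gamma> \<rho> k)"
proof -
  define \<psi> where "\<psi> = (\<lambda>t. c * t powr (1 - \<theta>))"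
  define p where "p = Suc m"
  define T where "T k = (\<Sum>j. d (k + j))" for k
  \<comment> \<open>Its inverse converts the bound on \<open>e powr \<theta>\<close> into one on
    \<open>e powr (1 - \<theta>)\<close>. It equals 1 exactly for \<theta> = 1/2, which separates
    the two rates.\<close>
  define s where "s = \<theta> / (1 - \<theta>)"
  have s: "1 \<le> s" using \<theta> by (simp add: s_def field_simps)
  have \<psi>_mono: "\<psi> u \<le> \<psi> t" if "0 \<le> u" "u \<le> t" for u t
    using that \<theta> c unfolding \<psi>_def by (intro mult_left_mono powr_mono2) auto
  have \<psi>0: "\<psi> 0 = 0" by (simp add: \<psi>_def)
  have KL': "\<forall>\<^sub>F j in sequentially. \<omega> < h (Suc j) \<longrightarrow> chord_bound \<psi> (b * d j) (h (Suc j) - \<omega>)"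
    using KL by (simp add: \<psi>_def)
  \<comment> \<open>\<psi> is monotone on the whole half-line, so the length 1 of the interval is
    arbitrary.\<close>
  have summable: "summable d"
    by (rule tail_estimate(1)[of 1 b \<psi>]) (use b \<psi>_mono \<psi>0 KL' in \<open>auto intro: mono_onI\<close>)
  have "\<exists>A>0. \<forall>\<^sub>F k in sequentially.
      (\<Sum>j. d (k + j)) \<le> (\<Sum>j\<in>{k - Suc m..<k}. d j) + A * \<psi> (M k - \<omega>)"
    by (rule tail_estimate(2)[of 1 b \<psi>]) (use b \<psi>_mono \<psi>0 KL' in \<open>auto intro: mono_onI\<close>)
  then obtain A where A: "0 < A" "\<forall>\<^sub>F k in sequentially.
      T k \<le> (\<Sum>j\<in>{k - p..<k}. d j) + A * \<psi> (M k - \<omega>)"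
    by (auto simp: T_def p_def)
  have sum_shift: "summable (\<lambda>j. d (k + j))" for k
    using summable summable_iff_shift[of d k] by (simp add: add.commute)
  have T_split: "T k = (\<Sum>j\<in>{k..<k + n}. d j) + T (k + n)" for k n
  proof -
    have "T k = (\<Sum>j. d (k + (j + n))) + (\<Sum>j<n. d (k + j))"
      unfolding T_def by (rule suminf_split_initial_segment[OF sum_shift])
    also have "(\<Sum>j<n. d (k + j)) = (\<Sum>j\<in>{k..<k + n}. d j)"
      using sum.shift_bounds_nat_ivl[of d 0 k n] by (simp add: atLeast0LessThan add.commute)
    finally show ?thesis by (simp add: T_def ac_simps)
  qed
  have T_nonneg: "0 \<le> T k" for k
    unfolding T_def by (intro suminf_nonneg sum_shift d_nonneg)
  have T_dec: "T j \<le> T i" if "i \<le> j" for i j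
    using T_split[of i "j - i"] that d_nonneg by (simp add: sum_nonneg)
  have "(\<lambda>k. d (j + k)) \<longlonglongrightarrow> 0" for j
    using limits(3) LIMSEQ_ignore_initial_segment[of d 0 j] by (simp add: add.commute)
  then have "(\<lambda>k. \<Sum>j<p. d (j + k)) \<longlonglongrightarrow> (\<Sum>j<p. 0)"
    by (intro tendsto_sum)
  moreover have "(\<Sum>j<p. d (j + k)) = T k - T (k + p)" for k
    using T_split[of k p] sum.shift_bounds_nat_ivl[of d 0 k p] by (simp add: atLeast0LessThan add.commute)
  ultimately have "(\<lambda>k. T k - T (k + p)) \<longlonglongrightarrow> 0" by simp
  then have "\<forall>\<^sub>F k in sequentially. T k - T (k + p) < 1"
    by (rule order_tendstoD) simp
  with A(2) KL' have "\<forall>\<^sub>F k in sequentially. T k - T (k + p) < 1 \<and>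
      T k \<le> (\<Sum>j\<in>{k - p..<k}. d j) + A * \<psi> (M k - \<omega>) \<and>
      (\<omega> < h (Suc k) \<longrightarrow> chord_bound \<psi> (b * d k) (h (Suc k) - \<omega>))"
    by eventually_elim simp
  then obtain K where K: "\<And>k. K \<le> k \<Longrightarrow> T k - T (k + p) < 1"
      "\<And>k. K \<le> k \<Longrightarrow> T k \<le> (\<Sum>j\<in>{k - p..<k}. d j) + A * \<psi> (M k - \<omega>)"
      "\<And>j. K \<le> j \<Longrightarrow> \<omega> < h (Suc j) \<Longrightarrow> chord_bound \<psi> (b * d j) (h (Suc j) - \<omega>)"
    unfolding eventually_sequentially by blast
  define B where "B = 1 + A * c * (b * c) powr (1 / s)"
  have B: "0 < B" using A c b by (auto simp: B_def intro!: add_pos_nonneg)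
  have rec: "T (k + p) powr s \<le> B powr s * (T k - T (k + p))" if k: "K \<le> k" for k
  proof -
    define D where "D = T k - T (k + p)"
    have D: "0 \<le> D" "D \<le> 1" using T_dec[of k "k + p"] K(1)[OF k] by (auto simp: D_def)
    have D_sum: "D = (\<Sum>j\<in>{k..<k + p}. d j)" using T_split[of k p] by (simp add: D_def)
    define e where "e = M (k + p) - \<omega>"
    have e: "0 \<le> e" using limits(4) by (simp add: e_def)
    have "e powr \<theta> \<le> b * c * D"
    proof (cases "e = 0")
      case True
      then show ?thesis using b c D \<theta> by simp
    next
      case False
      obtain l where l: "l \<in> {k + p - m..k + p}" "M (k + p) = h l" by (rule window_max_attained)
      define j where "j = l - 1"
      have j: "l = Suc j" "j \<in> {k..<k + p}" "K \<le> j" using l(1) k by (auto simp: j_def p_def)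
      have dj: "d j \<le> D" unfolding D_sum using j(2) d_nonneg by (intro member_le_sum) auto
      have "chord_bound \<psi> (b * d j) e"
        using K(3)[OF j(3)] False e l(2) j(1) by (simp add: e_def)
      from chord_boundD[OF this, of 0 e] have "e \<le> b * d j * \<psi> e" using e \<psi>0 by simp
      also have "\<dots> \<le> b * D * \<psi> e"
        using dj b c by (intro mult_right_mono mult_left_mono) (auto simp: \<psi>_def)
      finally have "e \<le> b * c * D * e powr (1 - \<theta>)" by (simp add: \<psi>_def algebra_simps)
      moreover have "e = e powr \<theta> * e powr (1 - \<theta>)"
        using e False by (simp flip: powr_add)
      ultimately have "e powr \<theta> * e powr (1 - \<theta>) \<le> b * c * D * e powr (1 - \<theta>)" by simp
      then show ?thesis using e False by simp
    qed
    then have "(e powr \<theta>) powr (1 / s) \<le> (b * c * D) powr (1 / s)"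
      using s by (intro powr_mono2) auto
    moreover have "(e powr \<theta>) powr (1 / s) = e powr (1 - \<theta>)"
      using \<theta> by (simp add: powr_powr s_def)
    ultimately have "\<psi> e \<le> c * ((b * c) powr (1 / s) * D powr (1 / s))"
      using c b D by (simp add: \<psi>_def powr_mult)
    then have "A * \<psi> e \<le> A * (c * ((b * c) powr (1 / s) * D powr (1 / s)))"
      using A by (intro mult_left_mono) auto
    \<comment> \<open>Here \<open>D \<le> 1\<close> and \<open>1 / s \<le> 1\<close> enter: the
      window sum is dominated by the power coming from KL.\<close>
    moreover have "D \<le> D powr (1 / s)"
      using powr_mono'[of "1 / s" 1 D] D s by simp
    ultimately have "D + A * \<psi> e \<le> B * D powr (1 / s)" by (simp add: B_def algebra_simps)
    then have "T (k + p) \<le> B * D powr (1 / s)"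
      using K(2)[of "k + p"] k by (simp add: D_sum e_def)
    then have "T (k + p) powr s \<le> (B * D powr (1 / s)) powr s"
      using T_nonneg s by (intro powr_mono2) auto
    also have "\<dots> = B powr s * D" using B D s by (simp add: powr_mult powr_powr)
    finally show ?thesis by (simp add: D_def)
  qed
  show ?thesis
  proof (cases "\<theta> = 1/2")
    case True
    then have "s = 1" by (simp add: s_def)
    then have "T (k + p) \<le> B * (T k - T (k + p))" if "K \<le> k" for k
      using rec[OF that] B T_nonneg[of "k + p"] by simp
    from geometric_rate[of T p B K, OF T_nonneg T_dec _ B this]
    obtain \<gamma> \<rho> where "0 < \<gamma>" "0 < \<rho>" "\<rho> < 1" "\<And>k. K \<le> k \<Longrightarrow> T k \<le> \<gamma> * \<rho> ^ k"
      by (auto simp: p_def)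
    then show ?thesis using True unfolding T_def rate_def by auto
  next
    case False
    then have "1 < s" using \<theta> by (simp add: s_def field_simps)
    moreover have "- 1 / (s - 1) = (1 - \<theta>) / (1 - 2 * \<theta>)"
      using \<theta> False by (simp add: s_def field_simps)
    moreover have "0 < B powr s" using B by simp
    ultimately obtain \<gamma> k1 where "0 < \<gamma>"
        "\<And>k. k1 \<le> k \<Longrightarrow> T k \<le> \<gamma> * real k powr ((1 - \<theta>) / (1 - 2 * \<theta>))"
      using sublinear_rate[of T s "B powr s" K p, OF T_nonneg T_dec _ _ rec] by auto
    \<comment> \<open>\<open>rate\<close> does not depend on \<rho> in this case; 1/2 is an
      arbitrary witness.\<close>
    then show ?thesis using False unfolding T_def rate_def
      by - (rule exI[of _ k1], rule exI[of _ \<gamma>], rule conjI, simp, rule exI[of _ "1/2"], simp)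
  qed
qed

end

section \<open>Subgradients and the proximal step\<close>

text \<open>Riesz representation in the standard basis gives existence; uniqueness of the derivative
  justifies the description operator in \<open>grad\<close>.\<close>

lemma gderiv_grad:
  fixes f :: "'a::euclidean_space \<Rightarrow> real"
  assumes "f differentiable at x"
  shows "GDERIV f x :> grad f x"
proof -
  obtain f' where f': "(f has_derivative f') (at x)"
    using assms by (auto simp: differentiable_def)
  then interpret linear f' by (rule has_derivative_linear)
  define v where "v = (\<Sum>i\<in>Basis. f' i *\<^sub>R i)"
  have "f' y = y \<bullet> v" for y
  proof -
    have "f' y = f' (\<Sum>i\<in>Basis. (y \<bullet> i) *\<^sub>R i)" by (simp add: euclidean_representation)
    also have "\<dots> = y \<bullet> v" by (simp add: sum scale v_def inner_sum_right mult.commute)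
    finally show ?thesis .
  qed
  then have "f' = (\<lambda>y. y \<bullet> v)" by (rule ext)
  with f' have v: "GDERIV f x :> v" by (simp add: gderiv_def)
  moreover have "w = v" if "GDERIV f x :> w" for w
  proof -
    have "(\<lambda>h. h \<bullet> w) = (\<lambda>h. h \<bullet> v)"
        using that v has_derivative_unique unfolding gderiv_def by blast
    then have "\<forall>h. h \<bullet> w = h \<bullet> v" by (simp add: fun_eq_iff)
    then show ?thesis by (simp only: vector_eq_ldot)
  qed
  ultimately show ?thesis unfolding grad_def by (rule theI)
qed

text \<open>Mean value inequality for \<open>f\<close> minus its linear part at \<open>w\<close>, on
  the ball around \<open>w\<close> through \<open>u\<close>. The constant is twice that of the usual
  descent lemma; only its order matters later.\<close>

lemma smooth_lower_bound:
  fixes f :: "'a::euclidean_space \<Rightarrow> real"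
  assumes "smooth_with L f"
  shows "f w + grad f w \<bullet> (u - w) - L * (norm (u - w))\<^sup>2 \<le> f u"
proof -
  define r where "r = norm (u - w)"
  have L: "L-lipschitz_on UNIV (grad f)" and diff: "f differentiable at x" for x
    using assms by (auto simp: smooth_with_def)
  have "norm ((f u - u \<bullet> grad f w) - (f w - w \<bullet> grad f w)) \<le> L * r * norm (u - w)"
  proof (rule differentiable_bound)
    show "convex (cball w r)" by simp
    show "u \<in> cball w r" "w \<in> cball w r" by (auto simp: r_def dist_norm norm_minus_commute)
    fix y assume y: "y \<in> cball w r"
    have "(f has_derivative (\<lambda>z. z \<bullet> grad f y)) (at y)"
      using gderiv_grad[OF diff] by (simp add: gderiv_def)
    from has_derivative_diff[OF this bounded_linear_imp_has_derivative[OF bounded_linear_inner_left, of "grad f w"]]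
    show "((\<lambda>z. f z - z \<bullet> grad f w) has_derivative (\<lambda>z. z \<bullet> (grad f y - grad f w))) (at y within cball w r)"
      by (simp add: inner_diff_right has_derivative_at_withinI)
    have "onorm (\<lambda>z. z \<bullet> (grad f y - grad f w)) \<le> norm (grad f y - grad f w)"
    proof (rule onorm_le)
      fix z show "norm (z \<bullet> (grad f y - grad f w)) \<le> norm (grad f y - grad f w) * norm z"
        using Cauchy_Schwarz_ineq2[of z "grad f y - grad f w"] by (simp add: mult.commute)
    qed
    also have "\<dots> \<le> L * dist y w"
      using lipschitz_onD[OF L, of y w] by (simp add: dist_norm)
    also have "\<dots> \<le> L * r"
      using y lipschitz_on_nonneg[OF L] by (intro mult_left_mono) (auto simp: dist_commute)
    finally show "onorm (\<lambda>z. z \<bullet> (grad f y - grad f w)) \<le> L * r" .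
  qed
  then show ?thesis by (simp add: r_def power2_eq_square inner_diff_left inner_commute[of "grad f w"] abs_le_iff)
qed

text \<open>A quadratic minorant bounds the difference quotient from below by
  \<open>- C * norm (y - x)\<close>, which tends to 0.\<close>

lemma regular_subdiffI:
  fixes h :: "'a::real_inner \<Rightarrow> ereal"
  assumes fin: "\<bar>h x\<bar> \<noteq> \<infinity>"
    and bound: "\<And>y. h x + ereal (v \<bullet> (y - x) - C * (norm (y - x))\<^sup>2) \<le> h y"
  shows "v \<in> regular_subdiff h x"
proof -
  obtain r where r: "h x = ereal r" using fin by auto
  have "((\<lambda>y. - C * norm (y - x)) \<longlongrightarrow> - C * norm (x - x)) (at x)"
    by (intro tendsto_intros)
  then have "((\<lambda>y. ereal (- C * norm (y - x))) \<longlongrightarrow> ereal 0) (at x)" by simp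
  then have lim: "((\<lambda>y. ereal (- C * norm (y - x))) \<longlongrightarrow> 0) (at x)"
    by (simp only: zero_ereal_def)
  have "0 \<le> Liminf (at x) (\<lambda>y. ereal (- C * norm (y - x)))"
  \<comment> \<open>In a trivial space \<open>at x\<close> is \<open>bot\<close>, where the limit
    inferior is \<infinity>.\<close>
  proof (cases "at x = bot")
    case False
    then show ?thesis using lim_imp_Liminf[OF False lim] by simp
  qed simp
  also have "Liminf (at x) (\<lambda>y. ereal (- C * norm (y - x)))
      \<le> Liminf (at x) (\<lambda>y. (h y - h x - ereal (v \<bullet> (y - x))) / ereal (norm (y - x)))"
  proof (rule Liminf_mono)
    have "ereal (- C * norm (y - x)) \<le> (h y - h x - ereal (v \<bullet> (y - x))) / ereal (norm (y - x))"
      if "y \<noteq> x" for y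
    proof (cases "h y")
      case (real s)
      have "- C * (norm (y - x))\<^sup>2 \<le> s - r - v \<bullet> (y - x)"
        using bound[of y] by (simp add: r real)
      then have "- C * norm (y - x) \<le> (s - r - v \<bullet> (y - x)) / norm (y - x)"
        using that by (simp add: field_simps power2_eq_square)
      then show ?thesis using that by (simp add: r real)
    next
      case PInf
      then show ?thesis using that by (simp add: r)
    next
      case MInf
      then show ?thesis using bound[of y] by (simp add: r)
    qed
    then show "\<forall>\<^sub>F y in at x. ereal (- C * norm (y - x))
        \<le> (h y - h x - ereal (v \<bullet> (y - x))) / ereal (norm (y - x))"
      by (auto simp: eventually_at_filter)
  qed
  finally show ?thesis using fin by (simp add: regular_subdiff_def)
qed

lemma regular_subset_limiting: "regular_subdiff h x \<subseteq> limiting_subdiff h x"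
proof
  fix v assume v: "v \<in> regular_subdiff h x"
  then have "\<bar>h x\<bar> \<noteq> \<infinity>" by (simp add: regular_subdiff_def)
  then show "v \<in> limiting_subdiff h x"
    unfolding limiting_subdiff_def using v
    by (intro CollectI conjI exI[where x = "\<lambda>_. x"] exI[where x = "\<lambda>_. v"]) auto
qed

text \<open>\<open>lower_semicont\<close> refers to the punctured filter \<open>at x\<close>,
  whereas the sequence may take the value \<open>x\<close>; choosing \<open>r\<close> below
  \<open>g x\<close> covers this case.\<close>

lemma lower_semicont_limit_le:
  fixes g :: "'a::metric_space \<Rightarrow> ereal"
  assumes lsc: "lower_semicont g" and X: "X \<longlonglongrightarrow> x" and g: "(\<lambda>n. g (X n)) \<longlonglongrightarrow> c"
  shows "g x \<le> c"
proof (rule ccontr)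
  assume "\<not> g x \<le> c"
  then obtain r where r: "c < r" "r < g x" using dense[of c "g x"] by (auto simp: not_le)
  then have "r < Liminf (at x) g"
    using lsc less_le_trans unfolding lower_semicont_def by blast
  then have "\<forall>\<^sub>F y in at x. r < g y" by (rule less_LiminfD)
  then have "\<forall>\<^sub>F y in nhds x. r < g y"
    using r(2) by (auto simp: eventually_at_filter elim!: eventually_mono)
  then have "\<forall>\<^sub>F n in sequentially. r < g (X n)"
    using X by (auto simp: filterlim_iff)
  moreover have "\<forall>\<^sub>F n in sequentially. g (X n) < r"
    using g r(1) by (rule order_tendstoD)
  ultimately have "\<forall>\<^sub>F n in sequentially. False"
    by eventually_elim simp
  then show False by simp
qed

text \<open>\<open>v\<close> is the subgradient given by the optimality condition of the proximal
  problem. Expanding the minimality inequality around \<open>w\<close> instead of calling on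
  subdifferential calculus gives a minorant on the whole space. Its curvature collects
  \<open>1 / (2 * \<tau>)\<close> from the proximal term and \<open>L\<close> from
  \<open>f\<close>.\<close>

lemma prox_step_bound:
  fixes f :: "'a::euclidean_space \<Rightarrow> real" and g F :: "'a \<Rightarrow> ereal"
  assumes f: "smooth_with L f" and g: "proper_fun g" and F: "F = (\<lambda>v. ereal (f v) + g v)"
    and \<tau>: "0 < \<tau>0" "\<tau>0 \<le> \<tau>" and w: "w \<in> prox \<tau> g (y - \<tau> *\<^sub>R grad f y)"
  shows "\<bar>F w\<bar> \<noteq> \<infinity>"
    and "\<exists>v. norm v \<le> (L + 1 / \<tau>0) * norm (w - y) \<and>
      (\<forall>u. F w + ereal (v \<bullet> (u - w) - (L + 1 / \<tau>0) * (norm (u - w))\<^sup>2) \<le> F u)"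
proof -
  define c where "c = y - \<tau> *\<^sub>R grad f y"
  have min: "ereal (1 / (2 * \<tau>) * (norm (w - c))\<^sup>2) + g w \<le> ereal (1 / (2 * \<tau>) * (norm (u - c))\<^sup>2) + g u" for u
    using w unfolding prox_def is_arg_min_def c_def by (auto simp: not_less)
  obtain u0 where u0: "g u0 < \<infinity>" using g by (auto simp: proper_fun_def dom_def)
  have no_minf: "g u \<noteq> - \<infinity>" for u using g by (auto simp: proper_fun_def)
  have "g w \<noteq> \<infinity>" using min[of u0] u0 by (cases "g u0") auto
  then obtain r where r: "g w = ereal r" using no_minf[of w] by (cases "g w") auto
  then show "\<bar>F w\<bar> \<noteq> \<infinity>" by (simp add: F)
  define v where "v = grad f w - grad f y - (1 / \<tau>) *\<^sub>R (w - y)"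
  have lip: "norm (grad f w - grad f y) \<le> L * norm (w - y)"
    using f lipschitz_onD[of L UNIV "grad f" w y] by (simp add: smooth_with_def dist_norm)
  have inv: "1 / \<tau> \<le> 1 / \<tau>0" using \<tau> by (simp add: frac_le)
  have "norm v \<le> norm (grad f w - grad f y) + norm ((1 / \<tau>) *\<^sub>R (w - y))"
    unfolding v_def by (rule norm_triangle_ineq4)
  also have "\<dots> \<le> L * norm (w - y) + 1 / \<tau>0 * norm (w - y)"
    using lip \<tau> inv by (intro add_mono) (auto intro: mult_right_mono simp: divide_inverse)
  finally have v: "norm v \<le> (L + 1 / \<tau>0) * norm (w - y)" by (simp add: algebra_simps)
  have "F w + ereal (v \<bullet> (u - w) - (L + 1 / \<tau>0) * (norm (u - w))\<^sup>2) \<le> F u" for u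
  proof (cases "g u")
    case (real s)
    have "1 / (2 * \<tau>) * (norm (w - c))\<^sup>2 + r \<le> 1 / (2 * \<tau>) * (norm (u - c))\<^sup>2 + s"
      using min[of u] by (simp add: r real)
    moreover have "(norm (u - c))\<^sup>2 = (norm (w - c))\<^sup>2 + 2 * ((w - c) \<bullet> (u - w)) + (norm (u - w))\<^sup>2"
      unfolding power2_norm_eq_inner by (simp add: inner_diff_left inner_diff_right inner_commute algebra_simps)
    ultimately have "r \<le> s + 1 / (2 * \<tau>) * (2 * ((w - c) \<bullet> (u - w)) + (norm (u - w))\<^sup>2)"
      by (simp add: algebra_simps add_divide_distrib)
    also have "\<dots> = s + (1 / \<tau>) * ((w - c) \<bullet> (u - w)) + 1 / (2 * \<tau>) * (norm (u - w))\<^sup>2"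
      using \<tau> by (simp add: field_simps)
    also have "(1 / \<tau>) * ((w - c) \<bullet> (u - w)) = (grad f w - v) \<bullet> (u - w)"
      using \<tau> by (simp add: c_def v_def inner_diff_left inner_add_left algebra_simps)
    finally have "r + (v - grad f w) \<bullet> (u - w) - 1 / (2 * \<tau>) * (norm (u - w))\<^sup>2 \<le> s"
      by (simp add: inner_diff_left)
    moreover have "f w + grad f w \<bullet> (u - w) - L * (norm (u - w))\<^sup>2 \<le> f u"
      by (rule smooth_lower_bound[OF f])
    moreover have "1 / (2 * \<tau>) * (norm (u - w))\<^sup>2 \<le> 1 / \<tau>0 * (norm (u - w))\<^sup>2"
      using \<tau> by (intro mult_right_mono frac_le) auto
    ultimately have "f w + r + (v \<bullet> (u - w) - (L + 1 / \<tau>0) * (norm (u - w))\<^sup>2) \<le> f u + s"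
      by (simp add: inner_diff_left algebra_simps)
    then show ?thesis by (simp add: F r real)
  qed (use no_minf in \<open>auto simp: F\<close>)
  then show "\<exists>v. norm v \<le> (L + 1 / \<tau>0) * norm (w - y) \<and>
      (\<forall>u. F w + ereal (v \<bullet> (u - w) - (L + 1 / \<tau>0) * (norm (u - w))\<^sup>2) \<le> F u)"
    using v by blast
qed

section \<open>Chord form of the KL inequality\<close>

text \<open>\<psi> need not be monotone here: if it drops from \<open>s\<close> to \<open>u\<close>,
  the given bound already forces \<open>u = s\<close>.\<close>

lemma chord_bound_mono:
  assumes "chord_bound \<psi> \<nu> t" "0 \<le> \<nu>" "\<nu> \<le> \<nu>'"
  shows "chord_bound \<psi> \<nu>' t"
  unfolding chord_bound_def
proof (intro allI impI)
  fix s u :: real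
  assume "0 \<le> s" "s \<le> u" "u \<le> t"
  then have le: "u - s \<le> \<nu> * (\<psi> u - \<psi> s)" by (rule chord_boundD[OF assms(1)])
  show "u - s \<le> \<nu>' * (\<psi> u - \<psi> s)"
  proof (cases "\<psi> s \<le> \<psi> u")
    case True
    then show ?thesis using le assms by (smt (verit) mult_right_mono)
  next
    case False
    then have "\<nu> * (\<psi> u - \<psi> s) \<le> 0" using assms by (simp add: mult_le_0_iff)
    then have "u = s" using le \<open>s \<le> u\<close> by simp
    then show ?thesis by simp
  qed
qed

lemma chord_bound_add:
  assumes "chord_bound \<phi> \<nu> t" "0 \<le> \<nu>" "mono_on {0..<\<eta>} \<psi>" "t < \<eta>"
  shows "chord_bound (\<lambda>u. \<phi> u + \<psi> u) \<nu> t"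
  unfolding chord_bound_def
proof (intro allI impI)
  fix s u :: real
  assume su: "0 \<le> s" "s \<le> u" "u \<le> t"
  then have "0 \<le> \<nu> * (\<psi> u - \<psi> s)" using assms mono_onD[OF assms(3), of s u] by simp
  then show "u - s \<le> \<nu> * (\<phi> u + \<psi> u - (\<phi> s + \<psi> s))"
    using chord_boundD[OF assms(1) su] by (simp add: algebra_simps)
qed

lemma chord_bound_cong:
  assumes "\<And>u. 0 \<le> u \<Longrightarrow> u \<le> t \<Longrightarrow> \<phi> u = \<psi> u"
  shows "chord_bound \<phi> \<nu> t \<longleftrightarrow> chord_bound \<psi> \<nu> t"
  using assms unfolding chord_bound_def by (intro iff_allI imp_cong refl) auto

text \<open>Concavity gives \<open>u powr \<kappa> - s powr \<kappa> \<ge> \<kappa> * u powr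
  \<kappa> * (1 - s / u)\<close>, obtained from Young's inequality. Since \<open>u \<le> 1\<close>
  and \<kappa> \<le> 1/2, moreover
  \<open>u powr (1 - \<kappa>) \<le> sqrt u \<le> d\<close>.\<close>

lemma chord_bound_powr:
  assumes \<kappa>: "0 < \<kappa>" "\<kappa> \<le> 1/2" and d: "0 \<le> d" and t: "t \<le> 1" "t \<le> d\<^sup>2"
  shows "chord_bound (\<lambda>u. u powr \<kappa>) (d / \<kappa>) t"
  unfolding chord_bound_def
proof (intro allI impI)
  fix s u :: real
  assume su: "0 \<le> s" "s \<le> u" "u \<le> t"
  show "u - s \<le> d / \<kappa> * (u powr \<kappa> - s powr \<kappa>)"
  proof (cases "u = 0")
    case False
    then have u: "0 < u" using su by simp
    have "(s / u) powr \<kappa> \<le> \<kappa> * (s / u) + (1 - \<kappa>)"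
    proof (cases "s = 0")
      case False
      then show ?thesis using Youngs_inequality_0[of \<kappa> "1 - \<kappa>" "s / u" 1] \<kappa> su u by simp
    qed (use \<kappa> in simp)
    then have "u powr \<kappa> * (s / u) powr \<kappa> \<le> u powr \<kappa> * (\<kappa> * (s / u) + (1 - \<kappa>))"
      by (intro mult_left_mono) auto
    moreover have "u powr \<kappa> * (s / u) powr \<kappa> = s powr \<kappa>"
      using u su by (simp flip: powr_mult)
    ultimately have 1: "\<kappa> * (u powr \<kappa> * (1 - s / u)) \<le> u powr \<kappa> - s powr \<kappa>"
      by (simp add: algebra_simps)
    have "u powr (1 - \<kappa>) \<le> u powr (1/2)"
      using u su t \<kappa> by (intro powr_mono') auto
    also have "\<dots> = sqrt u" using u by (simp add: powr_half_sqrt)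
    also have "\<dots> \<le> sqrt (d\<^sup>2)" using su t by (intro real_sqrt_le_mono) simp
    also have "\<dots> = d" using d by simp
    finally have "u powr (1 - \<kappa>) * u powr \<kappa> \<le> d * u powr \<kappa>" by (intro mult_right_mono) auto
    then have "u \<le> d * u powr \<kappa>" using u by (simp flip: powr_add)
    then have "u * (1 - s / u) \<le> d * u powr \<kappa> * (1 - s / u)"
      using su u by (intro mult_right_mono) auto
    also have "\<dots> = d / \<kappa> * (\<kappa> * (u powr \<kappa> * (1 - s / u)))" using \<kappa> by simp
    also have "\<dots> \<le> d / \<kappa> * (u powr \<kappa> - s powr \<kappa>)"
      using 1 d \<kappa> by (intro mult_left_mono) auto
    finally show ?thesis using u by (simp add: algebra_simps)
  qed (use su in simp)
qed

text \<open>Passes from values of \<open>F\<close> to values of \<open>H\<close>: if the quadratic term \<open>\<sigma>\<close> makes up less than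
  half of the excess \<open>t + \<sigma>\<close>, the inequality for \<open>F\<close> is used at half the argument; otherwise the
  step \<open>d\<close> is at least the square root of the excess, and the power function suffices.\<close>

lemma chord_bound_quadratic_term:
  assumes F: "0 < t \<Longrightarrow> chord_bound \<phi> (c * d) t" and c: "0 < c" and d: "0 \<le> d"
    and \<sigma>: "2 * \<sigma> \<le> d\<^sup>2" and pos: "0 < t + \<sigma>" and le1: "t + \<sigma> \<le> 1" and less: "t + \<sigma> < \<eta>"
    and mono: "mono_on {0..<\<eta>} \<phi>" and \<kappa>: "0 < \<kappa>" "\<kappa> \<le> 1/2"
  shows "chord_bound (\<lambda>u. \<phi> (u / 2) + u powr \<kappa>) ((2 * c + 1 / \<kappa>) * d) (t + \<sigma>)"
proof (cases "(t + \<sigma>) / 2 \<le> t")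
  case True
  have "chord_bound (\<lambda>u. \<phi> (u / 2)) (2 * c * d) (t + \<sigma>)"
    unfolding chord_bound_def
  proof (intro allI impI)
    fix s u :: real
    assume su: "0 \<le> s" "s \<le> u" "u \<le> t + \<sigma>"
    have "chord_bound \<phi> (c * d) t" using F True pos by simp
    from chord_boundD[OF this, of "s / 2" "u / 2"] su True
    show "u - s \<le> 2 * c * d * (\<phi> (u / 2) - \<phi> (s / 2))" by (simp add: algebra_simps)
  qed
  then have "chord_bound (\<lambda>u. \<phi> (u / 2) + u powr \<kappa>) (2 * c * d) (t + \<sigma>)"
    by (rule chord_bound_add[OF _ _ _ less])
      (use c d \<kappa> in \<open>auto intro!: mono_onI powr_mono2\<close>)
  then show ?thesis
    by (rule chord_bound_mono) (use c d \<kappa> in \<open>auto simp: algebra_simps\<close>)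
next
  case False
  have "chord_bound (\<lambda>u. u powr \<kappa> + \<phi> (u / 2)) (d / \<kappa>) (t + \<sigma>)"
  proof (rule chord_bound_add[OF _ _ _ less])
    show "chord_bound (\<lambda>u. u powr \<kappa>) (d / \<kappa>) (t + \<sigma>)"
      by (rule chord_bound_powr) (use \<kappa> d le1 \<sigma> False in auto)
    show "mono_on {0..<\<eta>} (\<lambda>u. \<phi> (u / 2))"
      using less pos by (auto intro!: mono_onI mono_onD[OF mono])
  qed (use d \<kappa> in simp)
  then have "chord_bound (\<lambda>u. u powr \<kappa> + \<phi> (u / 2)) ((2 * c + 1 / \<kappa>) * d) (t + \<sigma>)"
    by (rule chord_bound_mono) (use c d \<kappa> in \<open>auto simp: algebra_simps\<close>)
  then show ?thesis by (simp add: add.commute)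
qed

lemma desingularizing_mono:
  assumes \<phi>: "\<phi> \<in> desingularizing \<eta>" and \<eta>': "ereal \<eta>' \<le> \<eta>"
  shows "mono_on {0..<\<eta>'} \<phi>"
proof (rule mono_onI)
  fix s t assume st: "s \<in> {0..<\<eta>'}" "t \<in> {0..<\<eta>'}" "s \<le> t"
  have dom: "ereal u < \<eta>" if "u \<le> t" for u
    using that st \<eta>' less_le_trans[of "ereal u" "ereal \<eta>'" \<eta>] by simp
  show "\<phi> s \<le> \<phi> t"
  proof (rule DERIV_nonneg_imp_increasing_open[OF st(3)])
    fix u assume u: "s < u" "u < t"
    then have "\<phi> differentiable at u" "0 < deriv \<phi> u"
      using \<phi> dom[of u] st by (auto simp: desingularizing_def)
    then show "\<exists>y. DERIV \<phi> u :> y \<and> 0 \<le> y"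
      using DERIV_deriv_iff_real_differentiable less_imp_le by blast
  next
    have "continuous_on {t. 0 \<le> t \<and> ereal t < \<eta>} \<phi>" using \<phi> by (simp add: desingularizing_def)
    then show "continuous_on {s..t} \<phi>"
      by (rule continuous_on_subset) (use st dom in auto)
  qed
qed

text \<open>By concavity every chord of \<phi> over a subinterval of [0, t] is at least as steep as
  the tangent at \<open>t\<close>, so the KL inequality at the single argument \<open>t\<close>
  controls them all.\<close>

lemma KL_inequality_chord:
  assumes KL: "KL_inequality h y \<eta> U \<phi>" and \<phi>: "\<phi> \<in> desingularizing \<eta>"
    and h: "h y = ereal \<omega>" "h x = ereal r" "\<omega> < r" "ereal (r - \<omega>) < \<eta>"
    and x: "x \<in> U" and v: "v \<in> limiting_subdiff h x"
  shows "chord_bound \<phi> (norm v) (r - \<omega>)"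
proof -
  define t where "t = r - \<omega>"
  have t: "0 < t" "ereal t < \<eta>" using h by (auto simp: t_def)
  \<comment> \<open>A real number beyond \<open>t\<close> makes \<open>t\<close> an interior point
    of \<open>A\<close>, as the tangent inequality requires.\<close>
  obtain t' where t': "ereal t < ereal t'" "ereal t' < \<eta>" using ereal_dense2[OF t(2)] by blast
  define A where "A = {0..t'}"
  have A: "A \<subseteq> {t. 0 \<le> t \<and> ereal t < \<eta>}"
  proof
    fix u assume "u \<in> A"
    then have "0 \<le> u" "ereal u \<le> ereal t'" by (auto simp: A_def)
    then show "u \<in> {t. 0 \<le> t \<and> ereal t < \<eta>}" using le_less_trans[OF _ t'(2)] by simp
  qed
  have "dist_zero (limiting_subdiff h x) \<le> ereal (norm v)"
    unfolding dist_zero_def using v by (rule INF_lower)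
  moreover have deriv: "\<phi> differentiable at t" "0 < deriv \<phi> t"
    using \<phi> t by (auto simp: desingularizing_def)
  ultimately have "ereal (deriv \<phi> t) * dist_zero (limiting_subdiff h x) \<le> ereal (deriv \<phi> t) * ereal (norm v)"
    by (intro ereal_mult_left_mono) auto
  moreover have "1 \<le> ereal (deriv \<phi> t) * dist_zero (limiting_subdiff h x)"
  proof -
    have "h x < h y + \<eta>" using h by (cases \<eta>) auto
    moreover have "h y < h x" "real_of_ereal (h x - h y) = t" using h by (auto simp: t_def)
    ultimately show ?thesis using KL x unfolding KL_inequality_def by metis
  qed
  ultimately have "1 \<le> ereal (deriv \<phi> t) * ereal (norm v)" by (rule order_trans[rotated])
  then have slope: "1 \<le> deriv \<phi> t * norm v" by (simp add: one_ereal_def)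
  have convex: "convex_on A (\<lambda>u. - \<phi> u)"
    using \<phi> convex_on_subset[OF _ A] by (simp add: desingularizing_def concave_on_def A_def)
  have tangent: "\<phi> s \<le> \<phi> t + deriv \<phi> t * (s - t)" if "0 \<le> s" "s \<le> t" for s
  proof -
    have "- \<phi> s - (- \<phi> t) \<ge> - deriv \<phi> t * (s - t)"
    proof (rule convex_on_imp_above_tangent[OF convex])
      show "((\<lambda>u. - \<phi> u) has_field_derivative - deriv \<phi> t) (at t within A)"
        by (rule DERIV_minus[OF has_field_derivative_at_within])
          (use deriv(1) in \<open>simp add: DERIV_deriv_iff_real_differentiable\<close>)
    qed (use that t t' in \<open>auto simp: A_def interior_atLeastAtMost_real\<close>)
    then show ?thesis by simp
  qed
  have "chord_bound \<phi> (norm v) t"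
    unfolding chord_bound_def
  proof (intro allI impI)
    fix s u :: real
    assume su: "0 \<le> s" "s \<le> u" "u \<le> t"
    have "deriv \<phi> t * (u - s) \<le> \<phi> u - \<phi> s"
    proof (cases "s = u \<or> u = t")
      case True
      then show ?thesis using tangent[of s] su by (auto simp: algebra_simps)
    next
      case False
      have "(- \<phi> s - - \<phi> u) / (s - u) \<le> (- \<phi> s - - \<phi> t) / (s - t)"
        by (rule convex_on_slope_le[OF convex]) (use False su t t' in \<open>auto simp: A_def\<close>)
      also have "\<dots> \<le> - deriv \<phi> t"
        using tangent[of s] su False by (simp add: field_simps)
      finally show ?thesis using su False by (simp add: field_simps)
    qed
    then have "norm v * (deriv \<phi> t * (u - s)) \<le> norm v * (\<phi> u - \<phi> s)"
      by (intro mult_left_mono) auto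
    moreover have "1 * (u - s) \<le> (deriv \<phi> t * norm v) * (u - s)"
      using slope su by (intro mult_right_mono) auto
    ultimately show "u - s \<le> norm v * (\<phi> u - \<phi> s)" by (simp add: mult_ac)
  qed
  then show ?thesis by (simp add: t_def)
qed

text \<open>The neighborhoods of finitely many points cover all but finitely many terms, and the sum of
  the corresponding desingularizing functions works for all of them.\<close>

lemma uniform_chord_bound:
  fixes X :: "nat \<Rightarrow> 'a::heine_borel" and t \<nu> :: "nat \<Rightarrow> real"
  assumes bounded: "bounded (range X)" and t: "t \<longlonglongrightarrow> 0" and \<nu>: "\<And>k. 0 \<le> \<nu> k"
    and loc: "\<And>r y. strict_mono r \<Longrightarrow> (X \<circ> r) \<longlonglongrightarrow> y \<Longrightarrow>
      \<exists>U \<eta> \<psi>. open U \<and> y \<in> U \<and> 0 < \<eta> \<and> mono_on {0..<\<eta>} \<psi> \<and> 0 \<le> \<psi> 0 \<and>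
        (\<forall>\<^sub>F k in sequentially. X k \<in> U \<longrightarrow> 0 < t k \<longrightarrow> chord_bound \<psi> (\<nu> k) (t k))"
  shows "\<exists>\<eta> \<psi>. 0 < \<eta> \<and> mono_on {0..<\<eta>} \<psi> \<and> 0 \<le> \<psi> 0 \<and>
    (\<forall>\<^sub>F k in sequentially. 0 < t k \<longrightarrow> chord_bound \<psi> (\<nu> k) (t k))"
proof -
  define good where "good U \<longleftrightarrow> (\<exists>\<eta> \<psi>. 0 < \<eta> \<and> mono_on {0..<\<eta>} \<psi> \<and> 0 \<le> \<psi> 0 \<and>
    (\<forall>\<^sub>F k in sequentially. X k \<in> U \<longrightarrow> 0 < t k \<longrightarrow> chord_bound \<psi> (\<nu> k) (t k)))" for U
  have good_vacuous: "good U" if "\<forall>\<^sub>F k in sequentially. X k \<notin> U" for U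
    unfolding good_def
    by (rule exI[of _ 1], rule exI[of _ "\<lambda>_. 0"])
      (use that in \<open>auto intro!: mono_onI elim: eventually_mono\<close>)
  have good_Un: "good (U \<union> V)" if "good U" "good V" for U V
  proof -
    obtain \<eta>1 \<psi>1 where 1: "0 < \<eta>1" "mono_on {0..<\<eta>1} \<psi>1" "0 \<le> \<psi>1 0"
      "\<forall>\<^sub>F k in sequentially. X k \<in> U \<longrightarrow> 0 < t k \<longrightarrow> chord_bound \<psi>1 (\<nu> k) (t k)"
      using \<open>good U\<close> unfolding good_def by blast
    obtain \<eta>2 \<psi>2 where 2: "0 < \<eta>2" "mono_on {0..<\<eta>2} \<psi>2" "0 \<le> \<psi>2 0"
      "\<forall>\<^sub>F k in sequentially. X k \<in> V \<longrightarrow> 0 < t k \<longrightarrow> chord_bound \<psi>2 (\<nu> k) (t k)"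
      using \<open>good V\<close> unfolding good_def by blast
    define \<eta> where "\<eta> = min \<eta>1 \<eta>2"
    define \<psi> where "\<psi> u = \<psi>1 u + \<psi>2 u" for u
    have mono: "mono_on {0..<\<eta>} \<psi>1" "mono_on {0..<\<eta>} \<psi>2"
      by (rule mono_on_subset[OF 1(2)], simp add: \<eta>_def)
        (rule mono_on_subset[OF 2(2)], simp add: \<eta>_def)
    have "\<forall>\<^sub>F k in sequentially. t k < \<eta>"
      using t 1(1) 2(1) by (intro order_tendstoD) (auto simp: \<eta>_def)
    with 1(4) 2(4)
    have "\<forall>\<^sub>F k in sequentially. X k \<in> U \<union> V \<longrightarrow> 0 < t k \<longrightarrow> chord_bound \<psi> (\<nu> k) (t k)"
    proof eventually_elim
      case (elim k)
      show ?case
      proof (intro impI)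
        assume k: "X k \<in> U \<union> V" "0 < t k"
        consider "X k \<in> U" | "X k \<in> V" using k by blast
        then show "chord_bound \<psi> (\<nu> k) (t k)"
        proof cases
          case 1
          then show ?thesis unfolding \<psi>_def
            using elim k chord_bound_add[OF _ \<nu> mono(2)] by blast
        next
          case 2
          then have "chord_bound (\<lambda>u. \<psi>2 u + \<psi>1 u) (\<nu> k) (t k)"
            using elim k chord_bound_add[OF _ \<nu> mono(1)] by blast
          then show ?thesis by (simp add: \<psi>_def[abs_def] add.commute)
        qed
      qed
    qed
    moreover have "mono_on {0..<\<eta>} \<psi>"
      unfolding \<psi>_def by (intro mono_onI add_mono mono_onD[OF mono(1)] mono_onD[OF mono(2)])
    moreover have "0 < \<eta>" "0 \<le> \<psi> 0" using 1 2 by (auto simp: \<eta>_def \<psi>_def)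
    ultimately show ?thesis unfolding good_def by blast
  qed
  have local_good: "\<exists>U. open U \<and> y \<in> U \<and> good U" for y
  \<comment> \<open>A point with a neighborhood that the sequence eventually leaves is covered
    vacuously. Any other point is the limit of a subsequence, and \<open>loc\<close>
    applies.\<close>
  proof (cases "\<exists>U. open U \<and> y \<in> U \<and> (\<forall>\<^sub>F k in sequentially. X k \<notin> U)")
    case True
    then show ?thesis using good_vacuous by blast
  next
    case False
    have close: "\<exists>k>i. dist (X k) y < inverse (real (Suc n))" for n i
    proof -
      have "y \<in> ball y (inverse (real (Suc n)))" by simp
      then have "\<not> (\<forall>\<^sub>F k in sequentially. X k \<notin> ball y (inverse (real (Suc n))))"
        using False open_ball by blast
      then show ?thesis
        unfolding eventually_at_top_dense by (auto simp: dist_commute)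
    qed
    have "\<exists>r. \<forall>n. dist (X (r n)) y < inverse (real (Suc n)) \<and> r n < r (Suc n)"
      using close by (intro dependent_nat_choice) blast+
    then obtain r where r: "\<And>n. dist (X (r n)) y < inverse (real (Suc n))" "strict_mono r"
      by (auto simp: strict_mono_Suc_iff)
    have "(\<lambda>n. dist (X (r n)) y) \<longlonglongrightarrow> 0"
      by (rule tendsto_sandwich[OF _ _ tendsto_const LIMSEQ_inverse_real_of_nat])
        (use r(1) in \<open>auto intro!: always_eventually less_imp_le\<close>)
    then have "(X \<circ> r) \<longlonglongrightarrow> y" unfolding o_def by (rule tendsto_dist_iff[THEN iffD2])
    from loc[OF r(2) this] obtain U \<eta> \<psi> where "open U" "y \<in> U"
      and "0 < \<eta>" "mono_on {0..<\<eta>} \<psi>" "0 \<le> \<psi> 0"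
        "\<forall>\<^sub>F k in sequentially. X k \<in> U \<longrightarrow> 0 < t k \<longrightarrow> chord_bound \<psi> (\<nu> k) (t k)"
      by (elim exE conjE)
    moreover from this(3-) have "good U"
      unfolding good_def by (intro exI[of _ \<eta>] exI[of _ \<psi>] conjI)
    ultimately show ?thesis by (intro exI[of _ U] conjI)
  qed
  then obtain N where N: "\<And>y. open (N y)" "\<And>y. y \<in> N y" "\<And>y. good (N y)" by metis
  have "compact (closure (range X))" using bounded by simp
  moreover have "closure (range X) \<subseteq> (\<Union>y\<in>closure (range X). N y)" using N(2) by blast
  ultimately obtain S where S: "finite S" "closure (range X) \<subseteq> (\<Union>y\<in>S. N y)"
    using N(1) compactE_image[of "closure (range X)" "closure (range X)" N] by metis
  have "good (\<Union>y\<in>S. N y)"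
    using S(1) by (induction S rule: finite_induct) (auto intro: good_Un N good_vacuous)
  then obtain \<eta> \<psi> where \<psi>: "0 < \<eta>" "mono_on {0..<\<eta>} \<psi>" "0 \<le> \<psi> 0"
    "\<forall>\<^sub>F k in sequentially. X k \<in> (\<Union>y\<in>S. N y) \<longrightarrow> 0 < t k \<longrightarrow> chord_bound \<psi> (\<nu> k) (t k)"
    unfolding good_def by blast
  have "X k \<in> (\<Union>y\<in>S. N y)" for k using S(2) closure_subset[of "range X"] by blast
  then show ?thesis using \<psi> by auto
qed

section \<open>Convergence of nonmonotone subgradient descent\<close>

lemma zseq_Suc: "zseq x (Suc k) = (x (Suc k), x k)"
  by (simp add: zseq_def)

lemma step_ge:
  shows "norm (x (Suc k) - x k) \<le> step x k" and "norm (x k - x (k - 1)) \<le> step x k"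
  using norm_fst_le[of "x (Suc k) - x k" "x k - x (k - 1)"]
    norm_snd_le[of "x k - x (k - 1)" "x (Suc k) - x k"]
  by (simp_all add: step_def zseq_def)

text \<open>The interface between the algorithm and its convergence analysis. The index of
  \<open>v k\<close> is that of the step: it is a subgradient at \<open>X (Suc k)\<close>, bounded
  by the step leading there. One constant \<open>c\<close> bounds both slope and curvature of the
  minorants.\<close>

locale subgradient_descent =
  fixes F :: "'a::euclidean_space \<Rightarrow> ereal" and X v :: "nat \<Rightarrow> 'a" and m :: nat
    and \<delta> a c lb :: real
  assumes \<delta>: "0 < \<delta>" "\<delta> < 1" and a: "0 < a" and c: "0 < c"
    and lsc: "\<And>Y y l. Y \<longlonglongrightarrow> y \<Longrightarrow> (\<lambda>n. F (Y n)) \<longlonglongrightarrow> l \<Longrightarrow> F y \<le> l"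
    and lb: "\<And>y. ereal lb \<le> F y" and coercive: "coercive F"
    and fin: "\<And>k. \<bar>F (X k)\<bar> \<noteq> \<infinity>"
    and H_descent: "\<And>k. Hval F \<delta> X (Suc k) + a * (step X k)\<^sup>2 \<le> window_max m (Hval F \<delta> X) k"
    and norm_v: "\<And>k. norm (v k) \<le> c * step X k"
    and subgrad: "\<And>k y. F (X (Suc k)) +
      ereal (v k \<bullet> (y - X (Suc k)) - c * (norm (y - X (Suc k)))\<^sup>2) \<le> F y"
begin

definition Fval :: "nat \<Rightarrow> real" where
  "Fval k = real_of_ereal (F (X k))"

lemma F_eq: "F (X k) = ereal (Fval k)"
  using fin[of k] by (cases "F (X k)") (auto simp: Fval_def)

lemma Hval_eq: "Hval F \<delta> X k = Fval k + \<delta> / 2 * (norm (X k - X (k - 1)))\<^sup>2"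
  by (simp add: Hval_def H_def zseq_def F_eq)

lemma Fval_ge: "lb \<le> Fval k"
  using lb[of "X k"] by (simp add: F_eq)

lemma Fval_le_Hval: "Fval k \<le> Hval F \<delta> X k"
  using \<delta> by (simp add: Hval_eq)

lemma step_nonneg: "0 \<le> step X k"
  by (simp add: step_def)

text \<open>The minorant that touches \<open>F\<close> at the new iterate is evaluated at the old
  one; slope and curvature contribute \<open>c\<close> each.\<close>

lemma Fval_Suc_le: "Fval (Suc k) \<le> Fval k + 2 * c * (step X k)\<^sup>2"
proof -
  define s where "s = norm (X (Suc k) - X k)"
  have s: "0 \<le> s" "s \<le> step X k" using step_ge(1)[of X k] by (auto simp: s_def)
  have "\<bar>v k \<bullet> (X k - X (Suc k))\<bar> \<le> norm (v k) * s"
    using Cauchy_Schwarz_ineq2[of "v k" "X k - X (Suc k)"] by (simp add: s_def norm_minus_commute)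
  also have "\<dots> \<le> (c * step X k) * step X k"
    using norm_v s c step_nonneg by (intro mult_mono) auto
  finally have "- (c * (step X k)\<^sup>2) \<le> v k \<bullet> (X k - X (Suc k))"
    by (simp add: power2_eq_square abs_le_iff mult.assoc)
  moreover have "c * s\<^sup>2 \<le> c * (step X k)\<^sup>2" using s c by (intro mult_left_mono power_mono) auto
  ultimately show ?thesis
    using subgrad[of k "X k"] by (simp add: F_eq s_def norm_minus_commute)
qed

text \<open>In the ascent constant, \<open>2 * c\<close> is due to \<open>F\<close> and
  \<open>\<delta> / 2\<close> to the quadratic term of \<open>H\<close> at the new index; the one at
  the old index is dropped.\<close>

sublocale nonmonotone_descent "Hval F \<delta> X" "step X" m a "2 * c + \<delta> / 2" lb
proof
  fix k
  show "lb \<le> Hval F \<delta> X k" using Fval_ge[of k] Fval_le_Hval[of k] by simp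
  have "\<delta> / 2 * (norm (X (Suc k) - X k))\<^sup>2 \<le> \<delta> / 2 * (step X k)\<^sup>2"
    using \<delta> step_ge(1)[of X k] by (intro mult_left_mono power_mono) auto
  then show "Hval F \<delta> X (Suc k) \<le> Hval F \<delta> X k + (2 * c + \<delta> / 2) * (step X k)\<^sup>2"
    using Fval_Suc_le[of k] Fval_le_Hval[of k] by (simp add: Hval_eq[of "Suc k"] algebra_simps)
qed (use a c \<delta> step_nonneg H_descent in auto)

section \<open>Boundedness and cluster points of the iterates\<close>

lemma diff_tendsto: "(\<lambda>k. X k - X (k - 1)) \<longlonglongrightarrow> 0"
  by (rule tendsto_norm_zero_cancel, rule tendsto_sandwich[OF _ _ tendsto_const limits(3)])
    (use step_ge(2) in \<open>auto intro!: always_eventually\<close>)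

lemma Fval_tendsto: "Fval \<longlonglongrightarrow> \<omega>"
proof -
  have "(\<lambda>k. Hval F \<delta> X k - \<delta> / 2 * (norm (X k - X (k - 1)))\<^sup>2) \<longlonglongrightarrow> \<omega> - \<delta> / 2 * (norm (0::'a))\<^sup>2"
    by (intro tendsto_intros limits(1) diff_tendsto)
  then show ?thesis by (simp add: Hval_eq)
qed

lemma v_tendsto: "v \<longlonglongrightarrow> 0"
proof (rule tendsto_norm_zero_cancel, rule tendsto_sandwich[OF _ _ tendsto_const])
  show "(\<lambda>k. c * step X k) \<longlonglongrightarrow> 0" using tendsto_mult_right_zero[OF limits(3)] .
qed (use norm_v in auto)

lemma bounded_range: "bounded (range X)"
proof -
  have "\<forall>\<^sub>F y in at_infinity. ereal (M 0) < F y"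
    using coercive unfolding coercive_def by (rule order_tendstoD) simp
  then obtain B where B: "\<And>y. B \<le> norm y \<Longrightarrow> ereal (M 0) < F y"
    unfolding eventually_at_infinity by blast
  have "norm (X k) \<le> B" for k
  proof (rule ccontr)
    assume "\<not> norm (X k) \<le> B"
    then have "M 0 < Fval k" using B[of "X k"] by (simp add: F_eq)
    also have "\<dots> \<le> M 0"
      using Fval_le_Hval[of k] h_le_M[of k] M_decreasing[of 0 k] by simp
    finally show False by simp
  qed
  then show ?thesis by (auto simp: bounded_iff)
qed

lemma v_regular: "v k \<in> regular_subdiff F (X (Suc k))"
  by (rule regular_subdiffI[OF fin subgrad])

text \<open>Subgradients are attached to successor indices, so the subsequence has to be written
  with them. Dropping its first term makes all its indices positive.\<close>

lemma cluster_point_predecessors: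
  assumes r: "strict_mono r" and y: "(X \<circ> r) \<longlonglongrightarrow> y"
  obtains r' :: "nat \<Rightarrow> nat" where "strict_mono r'" "(\<lambda>n. X (Suc (r' n))) \<longlonglongrightarrow> y"
proof
  define r' where "r' n = r (Suc n) - 1" for n
  have r': "Suc (r' n) = r (Suc n)" for n
    using seq_suble[OF r, of "Suc n"] by (simp add: r'_def)
  have "Suc (r' n) < Suc (r' (Suc n))" for n
    unfolding r' using r by (simp add: strict_mono_Suc_iff)
  then show "strict_mono r'" by (simp add: strict_mono_Suc_iff)
  show "(\<lambda>n. X (Suc (r' n))) \<longlonglongrightarrow> y"
    using LIMSEQ_Suc[OF y] by (simp add: r' o_def)
qed

text \<open>Lower semicontinuity gives only \<open>F y \<le> \<omega>\<close>. The reverse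
  inequality comes from evaluating the minorants at \<open>y\<close>, as their slopes tend to
  0.\<close>

lemma F_cluster_point:
  assumes r: "strict_mono r" and y: "(X \<circ> r) \<longlonglongrightarrow> y"
  shows "F y = ereal \<omega>" and "0 \<in> limiting_subdiff F y"
proof -
  obtain r' where r': "strict_mono r'" and Xr: "(\<lambda>n. X (Suc (r' n))) \<longlonglongrightarrow> y"
    by (rule cluster_point_predecessors[OF r y])
  have Fr: "(\<lambda>n. Fval (Suc (r' n))) \<longlonglongrightarrow> \<omega>" and vr: "(\<lambda>n. v (r' n)) \<longlonglongrightarrow> 0"
    using LIMSEQ_subseq_LIMSEQ[OF LIMSEQ_Suc[OF Fval_tendsto] r']
      LIMSEQ_subseq_LIMSEQ[OF v_tendsto r'] by (simp_all add: o_def)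
  have Fr': "(\<lambda>n. F (X (Suc (r' n)))) \<longlonglongrightarrow> ereal \<omega>"
    using Fr by (simp add: F_eq)
  have "(\<lambda>n. Fval (Suc (r' n)) + (v (r' n) \<bullet> (y - X (Suc (r' n))) - c * (norm (y - X (Suc (r' n))))\<^sup>2))
      \<longlonglongrightarrow> \<omega> + (0 \<bullet> (y - y) - c * (norm (y - y))\<^sup>2)"
    by (intro tendsto_intros Xr Fr vr)
  then have lim: "(\<lambda>n. ereal (Fval (Suc (r' n)) + (v (r' n) \<bullet> (y - X (Suc (r' n))) - c * (norm (y - X (Suc (r' n))))\<^sup>2)))
      \<longlonglongrightarrow> ereal \<omega>" by simp
  have "ereal (Fval (Suc k) + (v k \<bullet> (y - X (Suc k)) - c * (norm (y - X (Suc k)))\<^sup>2)) \<le> F y" for k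
    using subgrad[of k y] by (simp add: F_eq)
  then have "ereal \<omega> \<le> F y" by (intro LIMSEQ_le_const2[OF lim] exI allI impI)
  with lsc[OF Xr Fr'] show Fy: "F y = ereal \<omega>" by (rule antisym)
  show "0 \<in> limiting_subdiff F y"
    unfolding limiting_subdiff_def
    by (intro CollectI conjI exI[of _ "\<lambda>n. X (Suc (r' n))"] exI[of _ "\<lambda>n. v (r' n)"])
      (use Fy Fr' Xr vr v_regular in auto)
qed

section \<open>The KL inequality along the iterates\<close>

lemma KL_chord_eventually:
  assumes KL: "KL_inequality F y \<eta> U \<phi>" and \<phi>: "\<phi> \<in> desingularizing \<eta>" and \<eta>: "0 < \<eta>"
    and y: "F y = ereal \<omega>"
  shows "\<forall>\<^sub>F k in sequentially. X (Suc k) \<in> U \<longrightarrow> 0 < Fval (Suc k) - \<omega> \<longrightarrow>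
    chord_bound \<phi> (c * step X k) (Fval (Suc k) - \<omega>)"
proof -
  have "(\<lambda>k. Fval (Suc k) - \<omega>) \<longlonglongrightarrow> \<omega> - \<omega>"
    by (intro tendsto_intros LIMSEQ_Suc Fval_tendsto)
  then have "(\<lambda>k. ereal (Fval (Suc k) - \<omega>)) \<longlonglongrightarrow> ereal 0" by simp
  then have "\<forall>\<^sub>F k in sequentially. ereal (Fval (Suc k) - \<omega>) < \<eta>"
    by (rule order_tendstoD) (use \<eta> in \<open>simp add: zero_ereal_def\<close>)
  then show ?thesis
  proof eventually_elim
    case (elim k)
    show ?case
    proof (intro impI)
      assume "X (Suc k) \<in> U" "0 < Fval (Suc k) - \<omega>"
      then have "chord_bound \<phi> (norm (v k)) (Fval (Suc k) - \<omega>)"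
        using KL_inequality_chord[OF KL \<phi> y F_eq _ elim, of "v k"]
          regular_subset_limiting[of F "X (Suc k)"] v_regular[of k] by auto
      then show "chord_bound \<phi> (c * step X k) (Fval (Suc k) - \<omega>)"
        by (rule chord_bound_mono) (use norm_v in auto)
    qed
  qed
qed

lemma H_chord_eventually:
  assumes F: "\<forall>\<^sub>F k in sequentially. 0 < Fval (Suc k) - \<omega> \<longrightarrow>
      chord_bound \<phi> (c * step X k) (Fval (Suc k) - \<omega>)"
    and \<eta>: "0 < \<eta>" and mono: "mono_on {0..<\<eta>} \<phi>" and \<kappa>: "0 < \<kappa>" "\<kappa> \<le> 1/2"
  shows "\<forall>\<^sub>F k in sequentially. \<omega> < Hval F \<delta> X (Suc k) \<longrightarrow>
    chord_bound (\<lambda>u. \<phi> (u / 2) + u powr \<kappa>) ((2 * c + 1 / \<kappa>) * step X k) (Hval F \<delta> X (Suc k) - \<omega>)"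
proof -
  \<comment> \<open>The excess must also be at most 1, where powers decrease in the exponent as
    \<open>chord_bound_powr\<close> requires.\<close>
  have "\<forall>\<^sub>F k in sequentially. Hval F \<delta> X (Suc k) < \<omega> + min \<eta> 1"
    using \<eta> by (intro order_tendstoD[OF LIMSEQ_Suc[OF limits(1)]]) auto
  with F show ?thesis
  proof eventually_elim
    case (elim k)
    define \<sigma> where "\<sigma> = \<delta> / 2 * (norm (X (Suc k) - X k))\<^sup>2"
    have H: "Hval F \<delta> X (Suc k) - \<omega> = (Fval (Suc k) - \<omega>) + \<sigma>" by (simp add: Hval_eq \<sigma>_def)
    have "2 * \<sigma> = \<delta> * (norm (X (Suc k) - X k))\<^sup>2" by (simp add: \<sigma>_def)
    also have "\<dots> \<le> 1 * (step X k)\<^sup>2"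
      using \<delta> step_ge(1)[of X k] by (intro mult_mono power_mono) auto
    finally have \<sigma>: "2 * \<sigma> \<le> (step X k)\<^sup>2" by simp
    show ?case
    proof
      assume "\<omega> < Hval F \<delta> X (Suc k)"
      then show "chord_bound (\<lambda>u. \<phi> (u / 2) + u powr \<kappa>) ((2 * c + 1 / \<kappa>) * step X k) (Hval F \<delta> X (Suc k) - \<omega>)"
        unfolding H
        by (intro chord_bound_quadratic_term[where \<eta> = \<eta>])
          (use elim \<sigma> c step_nonneg mono \<kappa> H in auto)
    qed
  qed
qed

text \<open>Convergence of the iterates is not yet known, so all cluster points are treated at once.
  The quadratic term of \<open>H\<close> is handled by the exponent 1/2.\<close>

lemma finite_length:
  assumes KL: "KL_function F"
  shows "summable (step X)"
proof -
  have "\<exists>\<eta> \<psi>. 0 < \<eta> \<and> mono_on {0..<\<eta>} \<psi> \<and> 0 \<le> \<psi> 0 \<and>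
    (\<forall>\<^sub>F k in sequentially. 0 < Fval (Suc k) - \<omega> \<longrightarrow> chord_bound \<psi> (c * step X k) (Fval (Suc k) - \<omega>))"
  proof (rule uniform_chord_bound[where X = "\<lambda>k. X (Suc k)"])
    show "bounded (range (\<lambda>k. X (Suc k)))"
      using bounded_range by (rule bounded_subset) auto
    show "(\<lambda>k. Fval (Suc k) - \<omega>) \<longlonglongrightarrow> 0"
      using LIM_zero[OF LIMSEQ_Suc[OF Fval_tendsto]] .
    show "0 \<le> c * step X k" for k using c step_nonneg by simp
  next
    fix r y
    assume r: "strict_mono r" and "((\<lambda>k. X (Suc k)) \<circ> r) \<longlonglongrightarrow> y"
    then have "strict_mono (\<lambda>n. Suc (r n))" "(X \<circ> (\<lambda>n. Suc (r n))) \<longlonglongrightarrow> y"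
      by (auto simp: strict_mono_def o_def)
    from F_cluster_point[OF this] have y: "F y = ereal \<omega>" "y \<in> dom_subdiff F"
      by (auto simp: dom_subdiff_def)
    then obtain \<eta> U \<phi> where \<phi>: "0 < \<eta>" "\<phi> \<in> desingularizing \<eta>" "open U" "y \<in> U" "KL_inequality F y \<eta> U \<phi>"
      using KL unfolding KL_function_def KL_at_def by blast
    \<comment> \<open>\<eta> may be infinite, whereas \<open>uniform_chord_bound\<close> works with
      a real bound.\<close>
    obtain \<eta>' where \<eta>': "0 < ereal \<eta>'" "ereal \<eta>' < \<eta>" using ereal_dense2[OF \<phi>(1)] by blast
    have "mono_on {0..<\<eta>'} \<phi>" using \<phi>(2) \<eta>'(2) by (intro desingularizing_mono) auto
    moreover have "0 \<le> \<phi> 0" using \<phi>(2) by (simp add: desingularizing_def)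
    ultimately show "\<exists>U \<eta> \<psi>. open U \<and> y \<in> U \<and> 0 < \<eta> \<and> mono_on {0..<\<eta>} \<psi> \<and> 0 \<le> \<psi> 0 \<and>
        (\<forall>\<^sub>F k in sequentially. X (Suc k) \<in> U \<longrightarrow> 0 < Fval (Suc k) - \<omega> \<longrightarrow>
          chord_bound \<psi> (c * step X k) (Fval (Suc k) - \<omega>))"
      using \<phi>(3,4) \<eta>'(1) KL_chord_eventually[OF \<phi>(5,2,1) y(1)]
      by (intro exI[of _ U] exI[of _ \<eta>'] exI[of _ \<phi>] conjI) auto
  qed
  then obtain \<eta> \<psi> where \<psi>: "0 < \<eta>" "mono_on {0..<\<eta>} \<psi>" "0 \<le> \<psi> 0"
    "\<forall>\<^sub>F k in sequentially. 0 < Fval (Suc k) - \<omega> \<longrightarrow> chord_bound \<psi> (c * step X k) (Fval (Suc k) - \<omega>)"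
    by blast
  show ?thesis
  proof (rule tail_estimate(1)[OF \<psi>(1) _ _ _ H_chord_eventually[OF \<psi>(4,1,2)]])
    show "mono_on {0..<\<eta>} (\<lambda>u. \<psi> (u / 2) + u powr (1/2))"
      by (intro mono_onI add_mono mono_onD[OF \<psi>(2)] powr_mono2) auto
  qed (use c \<psi>(3) in \<open>auto intro: add_pos_pos\<close>)
qed

text \<open>With a single limit, one neighborhood suffices and no sum of desingularizing functions
  destroys the exponent. For \<kappa> = 1 - \<theta> both summands of the function for
  \<open>H\<close> are multiples of the same power.\<close>

lemma rate_of_convergence:
  assumes KL: "KL_function_exponent \<theta> F" and \<theta>: "1/2 \<le> \<theta>" "\<theta> < 1" and y: "X \<longlonglongrightarrow> y"
  shows "\<exists>kb. \<exists>\<gamma>>0. \<exists>\<rho>. 0 < \<rho> \<and> \<rho> < 1 \<and> (\<forall>k\<ge>kb. (\<Sum>j. step X (k + j)) \<le> rate \<theta> \<gamma> \<rho> k)"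
proof -
  define \<kappa> where "\<kappa> = 1 - \<theta>"
  have \<kappa>: "0 < \<kappa>" "\<kappa> \<le> 1/2" using \<theta> by (auto simp: \<kappa>_def)
  have Fy: "F y = ereal \<omega>" "y \<in> dom_subdiff F"
    using F_cluster_point[of id y] y by (auto simp: dom_subdiff_def strict_mono_def)
  then obtain \<eta> U \<phi> c0 where \<phi>: "0 < \<eta>" "\<phi> \<in> desingularizing \<eta>" "open U" "y \<in> U" "KL_inequality F y \<eta> U \<phi>"
    and c0: "0 < c0" "\<And>t. 0 \<le> t \<Longrightarrow> ereal t < \<eta> \<Longrightarrow> \<phi> t = c0 * t powr \<kappa>"
    using KL unfolding KL_function_exponent_def KL_exponent_at_def \<kappa>_def by blast
  obtain \<eta>' where \<eta>': "0 < \<eta>'" "ereal \<eta>' < \<eta>" using ereal_dense2[OF \<phi>(1)] by auto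
  have "\<forall>\<^sub>F k in sequentially. X (Suc k) \<in> U"
    using topological_tendstoD[OF LIMSEQ_Suc[OF y] \<phi>(3,4)] .
  with KL_chord_eventually[OF \<phi>(5,2,1) Fy(1)]
  have "\<forall>\<^sub>F k in sequentially. 0 < Fval (Suc k) - \<omega> \<longrightarrow>
      chord_bound \<phi> (c * step X k) (Fval (Suc k) - \<omega>)"
    by eventually_elim simp
  then have "\<forall>\<^sub>F k in sequentially. \<omega> < Hval F \<delta> X (Suc k) \<longrightarrow>
      chord_bound (\<lambda>u. \<phi> (u / 2) + u powr \<kappa>) ((2 * c + 1 / \<kappa>) * step X k) (Hval F \<delta> X (Suc k) - \<omega>)"
    by (rule H_chord_eventually[OF _ \<eta>'(1) _ \<kappa>])
      (use \<phi>(2) \<eta>'(2) in \<open>auto intro: desingularizing_mono\<close>)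
  moreover have "\<forall>\<^sub>F k in sequentially. Hval F \<delta> X (Suc k) < \<omega> + \<eta>'"
    using \<eta>'(1) by (intro order_tendstoD[OF LIMSEQ_Suc[OF limits(1)]]) auto
  ultimately have "\<forall>\<^sub>F k in sequentially. \<omega> < Hval F \<delta> X (Suc k) \<longrightarrow>
      chord_bound (\<lambda>u. (c0 * (1/2) powr \<kappa> + 1) * u powr (1 - \<theta>))
        ((2 * c + 1 / \<kappa>) * step X k) (Hval F \<delta> X (Suc k) - \<omega>)"
  proof eventually_elim
    case (elim k)
    have "\<phi> (u / 2) + u powr \<kappa> = (c0 * (1/2) powr \<kappa> + 1) * u powr (1 - \<theta>)"
      if u: "0 \<le> u" "u \<le> Hval F \<delta> X (Suc k) - \<omega>" for u
    proof -
      have "ereal (u / 2) \<le> ereal \<eta>'" using u elim by simp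
      then have "ereal (u / 2) < \<eta>" using \<eta>'(2) by (rule le_less_trans)
      then have "\<phi> (u / 2) = c0 * (u / 2) powr \<kappa>" using c0(2)[of "u / 2"] u by simp
      moreover have "(u / 2) powr \<kappa> = (1/2 * u) powr \<kappa>" by simp
      then have "(u / 2) powr \<kappa> = (1/2) powr \<kappa> * u powr \<kappa>" by (simp only: powr_mult)
      ultimately have "\<phi> (u / 2) = c0 * ((1/2) powr \<kappa> * u powr \<kappa>)" by (simp only:)
      then show ?thesis by (simp only: \<kappa>_def distrib_right mult.assoc mult_1)
    qed
    from chord_bound_cong[OF this] show ?case using elim by simp
  qed
  then show ?thesis
    using c c0(1) \<kappa> by (intro tail_rate[OF \<theta>]) (auto intro!: add_pos_pos add_nonneg_pos)
qed

text \<open>The added vector is the gradient of the quadratic term of \<open>H\<close>. That term is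
  convex, so it lies above its linearization, which is added to the minorant of
  \<open>F\<close>.\<close>

lemma v_regular_H:
  "(v k + \<delta> *\<^sub>R (X (Suc k) - X k), - (\<delta> *\<^sub>R (X (Suc k) - X k))) \<in> regular_subdiff (H \<delta> F) (zseq X (Suc k))"
proof (rule regular_subdiffI)
  show "\<bar>H \<delta> F (zseq X (Suc k))\<bar> \<noteq> \<infinity>" by (simp add: H_def zseq_Suc F_eq)
next
  fix z :: "'a \<times> 'a"
  obtain y w where z: "z = (y, w)" by (cases z)
  define x u where "x = X (Suc k)" and "u = X k"
  have "(norm (y - w))\<^sup>2 - (norm (x - u))\<^sup>2 - 2 * ((x - u) \<bullet> ((y - x) - (w - u)))
      = (norm ((y - x) - (w - u)))\<^sup>2"
    unfolding power2_norm_eq_inner by (simp add: inner_diff_left inner_diff_right inner_commute algebra_simps)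
  then have "2 * ((x - u) \<bullet> ((y - x) - (w - u))) \<le> (norm (y - w))\<^sup>2 - (norm (x - u))\<^sup>2"
    by (smt (verit) zero_le_power2)
  then have "\<delta> / 2 * (2 * ((x - u) \<bullet> ((y - x) - (w - u)))) \<le> \<delta> / 2 * ((norm (y - w))\<^sup>2 - (norm (x - u))\<^sup>2)"
    using \<delta> by (intro mult_left_mono) auto
  then have quad: "\<delta> / 2 * (norm (x - u))\<^sup>2 + \<delta> * ((x - u) \<bullet> (y - x)) - \<delta> * ((x - u) \<bullet> (w - u))
      \<le> \<delta> / 2 * (norm (y - w))\<^sup>2"
    by (simp add: inner_diff_right algebra_simps)
  have "norm (y - x) \<le> norm (z - zseq X (Suc k))"
    using norm_fst_le[of "y - x" "w - u"] by (simp add: z zseq_Suc x_def u_def)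
  then have sq: "c * (norm (y - x))\<^sup>2 \<le> c * (norm (z - zseq X (Suc k)))\<^sup>2"
    using c by (intro mult_left_mono power_mono) auto
  have sub: "ereal (Fval (Suc k) + (v k \<bullet> (y - x) - c * (norm (y - x))\<^sup>2)) \<le> F y"
    using subgrad[of k y] by (simp add: F_eq x_def)
  show "H \<delta> F (zseq X (Suc k)) + ereal ((v k + \<delta> *\<^sub>R (X (Suc k) - X k), - (\<delta> *\<^sub>R (X (Suc k) - X k)))
      \<bullet> (z - zseq X (Suc k)) - c * (norm (z - zseq X (Suc k)))\<^sup>2) \<le> H \<delta> F z"
  proof (cases "F y")
    case (real s)
    have "F x = ereal (Fval (Suc k))" by (simp add: F_eq x_def)
    with real show ?thesis
      using sub quad sq
      by (simp add: H_def z zseq_Suc x_def[symmetric] u_def[symmetric] inner_add_left)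
  qed (use sub in \<open>auto simp: H_def z\<close>)
qed

lemma limit_critical:
  assumes y: "X \<longlonglongrightarrow> y"
  shows "(y, y) \<in> crit (H \<delta> F)"
proof -
  have Fy: "F y = ereal \<omega>" using F_cluster_point(1)[of id y] y by (simp add: strict_mono_def)
  define w where "w k = (v k + \<delta> *\<^sub>R (X (Suc k) - X k), - (\<delta> *\<^sub>R (X (Suc k) - X k)))" for k
  have diff: "(\<lambda>k. X (Suc k) - X k) \<longlonglongrightarrow> 0" using LIMSEQ_Suc[OF diff_tendsto] by simp
  have "w \<longlonglongrightarrow> (0 + \<delta> *\<^sub>R 0, - (\<delta> *\<^sub>R 0))"
    unfolding w_def by (intro tendsto_intros v_tendsto diff)
  then have w: "w \<longlonglongrightarrow> 0" by (simp add: zero_prod_def)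
  have "(\<lambda>k. ereal (Hval F \<delta> X (Suc k))) \<longlonglongrightarrow> ereal \<omega>"
    using LIMSEQ_Suc[OF limits(1)] by simp
  then have H: "(\<lambda>k. H \<delta> F (zseq X (Suc k))) \<longlonglongrightarrow> H \<delta> F (y, y)"
    by (simp add: H_def zseq_Suc F_eq Fy Hval_eq)
  have Z: "(\<lambda>k. zseq X (Suc k)) \<longlonglongrightarrow> (y, y)"
    unfolding zseq_Suc by (intro tendsto_intros y LIMSEQ_Suc[OF y])
  have "\<bar>H \<delta> F (y, y)\<bar> \<noteq> \<infinity>" by (simp add: H_def Fy)
  then show ?thesis
    unfolding crit_def limiting_subdiff_def
    by (intro CollectI conjI exI[of _ "\<lambda>k. zseq X (Suc k)"] exI[of _ w])
      (use w H Z v_regular_H in \<open>auto simp: w_def\<close>)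
qed

end

section \<open>Sequences of finite length in a complete space\<close>

lemma finite_length_limit:
  fixes Z :: "nat \<Rightarrow> 'b::banach"
  assumes "summable (\<lambda>k. norm (Z (Suc k) - Z k))"
  shows "\<exists>z. Z \<longlonglongrightarrow> z \<and> (\<forall>k. summable (\<lambda>j. norm (Z (Suc (k + j)) - Z (k + j))) \<and>
    norm (Z k - z) \<le> (\<Sum>j. norm (Z (Suc (k + j)) - Z (k + j))))"
proof -
  have sm: "summable (\<lambda>j. norm (Z (Suc (k + j)) - Z (k + j)))" for k
    using assms summable_iff_shift[of "\<lambda>k. norm (Z (Suc k) - Z k)" k] by (simp add: add.commute)
  have "summable (\<lambda>k. Z (Suc k) - Z k)" using assms by (rule summable_norm_cancel)
  then have "convergent (\<lambda>n. \<Sum>k<n. Z (Suc k) - Z k)" by (simp add: summable_iff_convergent)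
  then have "convergent (\<lambda>n. (Z n - Z 0) + Z 0)"
    by (intro convergent_add convergent_const) (simp add: sum_lessThan_telescope)
  then obtain z where z: "Z \<longlonglongrightarrow> z" by (auto simp: convergent_def)
  have tail: "norm (Z k - z) \<le> (\<Sum>j. norm (Z (Suc (k + j)) - Z (k + j)))" for k
  proof -
    have "(\<lambda>j. Z (k + j)) \<longlonglongrightarrow> z"
      using LIMSEQ_ignore_initial_segment[OF z, of k] by (simp add: add.commute)
    then have "(\<lambda>j. Z (k + Suc j) - Z (k + j)) sums (z - Z (k + 0))" by (rule telescope_sums)
    then have "z - Z k = (\<Sum>j. Z (Suc (k + j)) - Z (k + j))" by (simp add: sums_iff)
    then show ?thesis using summable_norm[OF sm[of k]] by (simp add: norm_minus_commute)
  qed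
  show ?thesis by (intro exI[of _ z] conjI allI z sm tail)
qed

section \<open>The PGenls algorithm\<close>

lemma PGenls_step:
  assumes run: "PGenls_run f g m \<delta> \<alpha> \<tau>min \<tau>max \<beta>max \<eta>1 \<eta>2 x" and \<eta>1: "0 < \<eta>1" "\<eta>1 < 1"
  obtains \<beta> \<tau> where "0 \<le> \<beta>" "\<beta> \<le> \<beta>max" "\<tau>min \<le> \<tau>"
    "x (Suc k) \<in> prox \<tau> g (extrap x k \<beta> - \<tau> *\<^sub>R grad f (extrap x k \<beta>))"
    "accepted (\<lambda>v. ereal (f v) + g v) m \<delta> \<alpha> x k (x (Suc k))"
proof -
  obtain \<beta>0 \<tau>0 n w where b: "\<beta>0 \<in> {0..\<beta>max}"
    and w: "\<forall>l\<le>n. let \<beta> = \<beta>0 * \<eta>1 ^ l; \<tau> = max (\<tau>0 * \<eta>2 ^ l) \<tau>min; y = extrap x k \<beta>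
               in w l \<in> prox \<tau> g (y - \<tau> *\<^sub>R grad f y)"
    and acc: "accepted (\<lambda>v. ereal (f v) + g v) m \<delta> \<alpha> x k (w n)" "x (Suc k) = w n"
    using run[unfolded PGenls_run_def, THEN conjunct2, THEN spec, of k]
    by (elim bexE exE conjE)
  show ?thesis
  proof (rule that)
    show "0 \<le> \<beta>0 * \<eta>1 ^ n" using b \<eta>1 by simp
    have "\<beta>0 * \<eta>1 ^ n \<le> \<beta>0 * 1" using b \<eta>1 by (intro mult_left_mono power_le_one) auto
    then show "\<beta>0 * \<eta>1 ^ n \<le> \<beta>max" using b by simp
    show "\<tau>min \<le> max (\<tau>0 * \<eta>2 ^ n) \<tau>min" by simp
  qed (use w acc in \<open>auto simp: Let_def\<close>)
qed

lemma PGenls_subgradient_descent: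
  fixes f :: "'a::euclidean_space \<Rightarrow> real" and g F :: "'a \<Rightarrow> ereal"
  assumes f: "smooth_with L f" and g: "proper_fun g" "lower_semicont g"
    and F: "F = (\<lambda>v. ereal (f v) + g v)" "coercive F" "bounded_below_fun F"
    and \<delta>: "0 < \<delta>" "\<delta> < 1" and \<alpha>: "0 < \<alpha>" and \<tau>min: "0 < \<tau>min" and \<beta>max: "0 \<le> \<beta>max"
    and \<eta>1: "0 < \<eta>1" "\<eta>1 < 1"
    and run: "PGenls_run f g m \<delta> \<alpha> \<tau>min \<tau>max \<beta>max \<eta>1 \<eta>2 x"
  obtains v c lb where "subgradient_descent F x v m \<delta> (\<alpha> / 2) c lb"
proof -
  have L: "0 \<le> L" using f lipschitz_on_nonneg by (auto simp: smooth_with_def)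
  define c0 where "c0 = L + 1 / \<tau>min"
  \<comment> \<open>The distance of the new iterate to the extrapolated point is at most the new
    increment plus \<beta> times the previous one, and both are bounded by
    \<open>step x k\<close>.\<close>
  define c where "c = c0 * (1 + \<beta>max)"
  have c0: "0 < c0" using L \<tau>min by (simp add: c0_def add_nonneg_pos)
  have c: "0 < c" "c0 \<le> c" using c0 \<beta>max by (auto simp: c_def)
  obtain lb where lb: "\<And>y. ereal lb \<le> F y" using F(3) by (auto simp: bounded_below_fun_def)
  have "\<exists>u. \<bar>F (x (Suc k))\<bar> \<noteq> \<infinity> \<and> norm u \<le> c * step x k \<and>
      (\<forall>y. F (x (Suc k)) + ereal (u \<bullet> (y - x (Suc k)) - c * (norm (y - x (Suc k)))\<^sup>2) \<le> F y)" for k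
  proof -
    obtain \<beta> \<tau> where \<beta>: "0 \<le> \<beta>" "\<beta> \<le> \<beta>max" and \<tau>: "\<tau>min \<le> \<tau>"
      and prox: "x (Suc k) \<in> prox \<tau> g (extrap x k \<beta> - \<tau> *\<^sub>R grad f (extrap x k \<beta>))"
      by (rule PGenls_step[OF run \<eta>1])
    note bound = prox_step_bound[OF f g(1) F(1) \<tau>min \<tau> prox]
    obtain u where u: "norm u \<le> c0 * norm (x (Suc k) - extrap x k \<beta>)"
      and sub: "\<forall>y. F (x (Suc k)) + ereal (u \<bullet> (y - x (Suc k)) - c0 * (norm (y - x (Suc k)))\<^sup>2) \<le> F y"
      using bound(2) unfolding c0_def by blast
    have "norm (x (Suc k) - extrap x k \<beta>) = norm ((x (Suc k) - x k) - \<beta> *\<^sub>R (x k - x (k - 1)))"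
      by (simp add: extrap_def algebra_simps)
    also have "\<dots> \<le> norm (x (Suc k) - x k) + \<beta> * norm (x k - x (k - 1))"
      using norm_triangle_ineq4[of "x (Suc k) - x k" "\<beta> *\<^sub>R (x k - x (k - 1))"] \<beta> by simp
    also have "\<dots> \<le> step x k + \<beta>max * step x k"
      using step_ge[of x k] \<beta> by (intro add_mono mult_mono) auto
    finally have "c0 * norm (x (Suc k) - extrap x k \<beta>) \<le> c0 * ((1 + \<beta>max) * step x k)"
      using c0 by (intro mult_left_mono) (auto simp: algebra_simps)
    with u have "norm u \<le> c * step x k" by (simp add: c_def)
    moreover have "F (x (Suc k)) + ereal (u \<bullet> (y - x (Suc k)) - c * (norm (y - x (Suc k)))\<^sup>2) \<le> F y" for y
    proof -
      have "c0 * (norm (y - x (Suc k)))\<^sup>2 \<le> c * (norm (y - x (Suc k)))\<^sup>2"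
        using c by (intro mult_right_mono) auto
      then have "F (x (Suc k)) + ereal (u \<bullet> (y - x (Suc k)) - c * (norm (y - x (Suc k)))\<^sup>2)
          \<le> F (x (Suc k)) + ereal (u \<bullet> (y - x (Suc k)) - c0 * (norm (y - x (Suc k)))\<^sup>2)"
        by (intro add_left_mono) simp
      then show ?thesis using sub order_trans by blast
    qed
    ultimately show ?thesis using bound(1) by (intro exI[of _ u] conjI allI)
  qed
  then obtain v where v: "\<And>k. \<bar>F (x (Suc k))\<bar> \<noteq> \<infinity>" "\<And>k. norm (v k) \<le> c * step x k"
    "\<And>k y. F (x (Suc k)) + ereal (v k \<bullet> (y - x (Suc k)) - c * (norm (y - x (Suc k)))\<^sup>2) \<le> F y"
    by metis
  have fin: "\<bar>F (x k)\<bar> \<noteq> \<infinity>" for k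
  proof (cases k)
    case 0
    have "g (x 0) < \<infinity>" "g (x 0) \<noteq> - \<infinity>"
      using run g(1) by (auto simp: PGenls_run_def dom_def proper_fun_def)
    then show ?thesis using 0 by (cases "g (x 0)") (auto simp: F(1))
  qed (use v(1) in simp)
  have H: "H \<delta> F (zseq x k) = ereal (Hval F \<delta> x k)" for k
    using fin[of k] by (cases "F (x k)") (auto simp: Hval_def H_def zseq_def)
  have "subgradient_descent F x v m \<delta> (\<alpha> / 2) c lb"
  proof
    fix Y :: "nat \<Rightarrow> 'a" and y l
    assume Y: "Y \<longlonglongrightarrow> y" and FY: "(\<lambda>n. F (Y n)) \<longlonglongrightarrow> l"
    \<comment> \<open>Subtracting the finite continuous \<open>f\<close> reduces the claim to lower
      semicontinuity of \<open>g\<close>.\<close>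
    have "isCont f y"
      using f by (auto simp: smooth_with_def intro: differentiable_imp_continuous_within)
    then have "(\<lambda>n. ereal (f (Y n))) \<longlonglongrightarrow> ereal (f y)"
      using Y by (simp add: isCont_tendsto_compose)
    then have "(\<lambda>n. F (Y n) - ereal (f (Y n))) \<longlonglongrightarrow> l - ereal (f y)"
      using FY by (intro tendsto_diff_ereal_general) auto
    moreover have "F (Y n) - ereal (f (Y n)) = g (Y n)" for n
      by (cases "g (Y n)") (auto simp: F(1))
    ultimately have "g y \<le> l - ereal (f y)"
      using lower_semicont_limit_le[OF g(2) Y] by simp
    then show "F y \<le> l" by (simp add: F(1) ereal_le_minus add.commute)
  next
    fix k
    have acc: "accepted F m \<delta> \<alpha> x k (x (Suc k))"
      using PGenls_step[OF run \<eta>1, of k] F(1) by metis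
    have "Max ((\<lambda>j. H \<delta> F (zseq x j)) ` {k - m..k}) = Max (ereal ` Hval F \<delta> x ` {k - m..k})"
      by (simp add: H image_image)
    also have "\<dots> = ereal (window_max m (Hval F \<delta> x) k)"
      unfolding window_max_def by (rule mono_Max_commute[symmetric]) (auto intro: monoI)
    finally show "Hval F \<delta> x (Suc k) + \<alpha> / 2 * (step x k)\<^sup>2 \<le> window_max m (Hval F \<delta> x) k"
      using acc H[of "Suc k"] by (simp add: accepted_def zseq_Suc[symmetric] step_def)
  qed (use \<delta> \<alpha> c(1) lb F(2) fin v in auto)
  then show ?thesis by (rule that)
qed

theorem theorem4p4:
  fixes f :: "'a::euclidean_space \<Rightarrow> real" and g F :: "'a \<Rightarrow> ereal"
    and Lf \<delta> \<alpha> \<tau>min \<tau>max \<beta>max \<eta>1 \<eta>2 :: real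
    and m :: nat and x :: "nat \<Rightarrow> 'a"
  assumes "smooth_with Lf f"
    and "proper_fun g" and "lower_semicont g" and "bounded_below_fun g"
    and F_def: "F = (\<lambda>v. ereal (f v) + g v)"
    and "coercive F" and "bounded_below_fun F"
    and "KL_function F"
    and "0 < \<delta>" and "\<delta> < 1/2" and "0 < \<alpha>" and "\<alpha> < \<delta> / 2"
    and "0 < \<tau>min" and "\<tau>min \<le> 1 / (2 * (\<alpha> + \<delta>) + Lf)" and "1 / (2 * (\<alpha> + \<delta>) + Lf) < \<tau>max"
    and "0 \<le> \<beta>max" and "0 < \<eta>1" and "\<eta>1 < 1" and "0 < \<eta>2" and "\<eta>2 < 1"
    and "PGenls_run f g m \<delta> \<alpha> \<tau>min \<tau>max \<beta>max \<eta>1 \<eta>2 x"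
  shows
    "((liminf_on (K1 F m \<delta> \<alpha> x) (decrease_ratio F m \<delta> x) = 0 \<longrightarrow>
         (\<lambda>k. sqrt (gap F m \<delta> x k)) summable_on K1 F m \<delta> \<alpha> x) \<longrightarrow>
       summable (\<lambda>k. norm (zseq x (k + 1) - zseq x k)))
     \<and>
     convergent (Hval F \<delta> x)
     \<and>
     (\<forall>\<theta>. 1/2 \<le> \<theta> \<and> \<theta> < 1 \<and> KL_function_exponent \<theta> F \<and>
        (\<exists>k0. \<exists>\<gamma>0>0. \<exists>\<tau>0. 0 < \<tau>0 \<and> \<tau>0 < 1 \<and>
           (\<forall>k\<ge>k0.
              (\<lambda>j. sqrt (gap F m \<delta> x j)) summable_on {j \<in> K2 F m \<delta> \<alpha> \<theta> x \<union> K31 F m \<delta> \<alpha> \<theta> x. j \<ge> k} \<and>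
              (\<Sum>\<^sub>\<infinity>j\<in>{j \<in> K2 F m \<delta> \<alpha> \<theta> x \<union> K31 F m \<delta> \<alpha> \<theta> x. j \<ge> k}. sqrt (gap F m \<delta> x j))
                \<le> rate \<theta> \<gamma>0 \<tau>0 k)) \<longrightarrow>
        (\<exists>zt \<in> crit (H \<delta> F). zseq x \<longlonglongrightarrow> zt \<and>
           (\<exists>kb. \<exists>\<gamma>>0. \<exists>\<rho>. 0 < \<rho> \<and> \<rho> < 1 \<and>
              (\<forall>k\<ge>kb.
                 summable (\<lambda>j. norm (zseq x (k + j + 1) - zseq x (k + j))) \<and>
                 norm (zseq x k - zt) \<le> (\<Sum>j. norm (zseq x (k + j + 1) - zseq x (k + j))) \<and>
                 (\<Sum>j. norm (zseq x (k + j + 1) - zseq x (k + j))) \<le> rate \<theta> \<gamma> \<rho> k))))"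
  proof -
  obtain v c lb where "subgradient_descent F x v m \<delta> (\<alpha> / 2) c lb"
    using PGenls_subgradient_descent[of Lf f g F \<delta> \<alpha> \<tau>min \<beta>max \<eta>1 m \<tau>max \<eta>2 x] assms by auto
  then interpret subgradient_descent F x v m \<delta> "\<alpha> / 2" c lb .
  have length: "summable (\<lambda>k. norm (zseq x (Suc k) - zseq x k))"
    using finite_length[OF \<open>KL_function F\<close>] by (simp add: step_def[abs_def])
  obtain zt where zt: "zseq x \<longlonglongrightarrow> zt"
    and tail: "\<forall>k. summable (\<lambda>j. norm (zseq x (Suc (k + j)) - zseq x (k + j))) \<and>
      norm (zseq x k - zt) \<le> (\<Sum>j. norm (zseq x (Suc (k + j)) - zseq x (k + j)))"
    using finite_length_limit[OF length] by (elim exE conjE)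
  define y where "y = fst zt"
  have xy: "x \<longlonglongrightarrow> y"
    using tendsto_fst[OF zt] by (simp add: zseq_def y_def)
  \<comment> \<open>The second component is the shifted first one, so the limit lies on the
    diagonal, where \<open>limit_critical\<close> applies.\<close>
  then have "(\<lambda>k. zseq x (Suc k)) \<longlonglongrightarrow> (y, y)"
    unfolding zseq_Suc by (intro tendsto_intros LIMSEQ_Suc)
  then have "zt = (y, y)" using LIMSEQ_Suc[OF zt] LIMSEQ_unique by blast
  then have crit: "zt \<in> crit (H \<delta> F)" using limit_critical[OF xy] by simp
  show ?thesis
  proof (intro conjI impI allI)
    show "summable (\<lambda>k. norm (zseq x (k + 1) - zseq x k))" using length by simp
    show "convergent (Hval F \<delta> x)" using limits(1) by (auto simp: convergent_def)
  next
    fix \<theta> :: real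
    assume "1/2 \<le> \<theta> \<and> \<theta> < 1 \<and> KL_function_exponent \<theta> F \<and>
        (\<exists>k0. \<exists>\<gamma>0>0. \<exists>\<tau>0. 0 < \<tau>0 \<and> \<tau>0 < 1 \<and>
           (\<forall>k\<ge>k0.
              (\<lambda>j. sqrt (gap F m \<delta> x j)) summable_on {j \<in> K2 F m \<delta> \<alpha> \<theta> x \<union> K31 F m \<delta> \<alpha> \<theta> x. j \<ge> k} \<and>
              (\<Sum>\<^sub>\<infinity>j\<in>{j \<in> K2 F m \<delta> \<alpha> \<theta> x \<union> K31 F m \<delta> \<alpha> \<theta> x. j \<ge> k}. sqrt (gap F m \<delta> x j))
                \<le> rate \<theta> \<gamma>0 \<tau>0 k))"
    then have \<theta>: "KL_function_exponent \<theta> F" "1/2 \<le> \<theta>" "\<theta> < 1" by simp_all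
    obtain kb \<gamma> \<rho> where "0 < \<gamma>" "0 < \<rho>" "\<rho> < 1"
      and "\<forall>k\<ge>kb. (\<Sum>j. norm (zseq x (k + j + 1) - zseq x (k + j))) \<le> rate \<theta> \<gamma> \<rho> k"
      using rate_of_convergence[OF \<theta> xy] unfolding step_def by (elim exE conjE)
    then show "\<exists>zt \<in> crit (H \<delta> F). zseq x \<longlonglongrightarrow> zt \<and>
           (\<exists>kb. \<exists>\<gamma>>0. \<exists>\<rho>. 0 < \<rho> \<and> \<rho> < 1 \<and>
              (\<forall>k\<ge>kb.
                 summable (\<lambda>j. norm (zseq x (k + j + 1) - zseq x (k + j))) \<and>
                 norm (zseq x k - zt) \<le> (\<Sum>j. norm (zseq x (k + j + 1) - zseq x (k + j))) \<and>
                 (\<Sum>j. norm (zseq x (k + j + 1) - zseq x (k + j))) \<le> rate \<theta> \<gamma> \<rho> k))"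
      using tail zt
      by - (rule bexI[OF _ crit], rule conjI, assumption, rule exI[of _ kb], rule exI[of _ \<gamma>],
        rule conjI, assumption, rule exI[of _ \<rho>], simp)
  qed
qed

end
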